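(* Let $\Delta$ be a $(d-1)$-dimensional flag homology sphere (over a field $\mathbb{K}$) with polar size $\pi_\Delta>1$, and let $v_0$ be a vertex with $\iota(v_0)=\pi_\Delta$. (i) If $\mathrm{lk}_\Delta(v_0)\cong\Sigma\Gamma$ for some $(d-3)$-dimensional flag homology sphere $\Gamma$, then $\Delta\cong\Gamma*C_{\pi_\Delta+3}$; moreover $\pi_\Delta-1$ divides the highest degree coefficient of $\gamma^\Delta(t)$. (ii) If $d\geq 4$ and $\pi_\Delta=\gamma_1^\Delta$, then $\Delta\cong C_5*C_{\pi_\Delta+3}$ (and $d=4$).
   Context: A simplicial complex is a finite family of subsets (faces) of a finite vertex set, closed under subsets, with every vertex a face; pure of dimension $d-1$ if all maximal faces have $d$ elements. Link: $\mathrm{lk}_\Delta(f)=\{g\in\Delta:g\cap f=\emptyset,\ g\cup f\in\Delta\}$. A $(d-1)$-dimensional homology sphere over $\mathbb{K}$ is a pure $(d-1)$-dimensional complex such that for every face $f$ (including $\emptyset$), $\tilde H_i(\mathrm{lk}_\Delta(f);\mathbb{K})$ is $0$ for $i<d-1-|f|$ and $\mathbb{K}$ for $i=d-1-|f|$. Flag: every minimal non-face has two elements. With $f_i$ the number of faces of cardinality $i$ ($f_0=1$) and $h(z)=\sum_{i=0}^d f_i(z-1)^{d-i}$, write uniquely $h(z)=\sum_{i=0}^{\lfloor d/2\rfloor}\gamma_iz^i(1+z)^{d-2i}$; $\gamma^\Delta(t)=\sum_i\gamma_it^i$, so $\gamma_1=f_1-2d$. An antipode of $v$ is a vertex $w\ne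 v$ with $\{v,w\}\notin\Delta$; $\iota(v)$ = number of antipodes; polar size $\pi_\Delta=\min_v\iota(v)$. Join: $\Delta_1*\Delta_2=\{f_1\sqcup f_2:f_i\in\Delta_i\}$ (disjoint vertex sets); suspension $\Sigma\Delta=S^0*\Delta$ with $S^0$ two isolated vertices. $C_k$ is the $1$-dimensional complex of a $k$-cycle graph. *)

theory Defs
  imports "HOL-Computational_Algebra.Polynomial"
begin

section \<open>Simplicial complexes\<close>

text \<open>A complex is given by its set of faces. Since every vertex is a face, the vertex set is
  the union of the faces. The empty set is always a face.\<close>

definition vertices :: "'a set set \<Rightarrow> 'a set" where
  "vertices \<Delta> = \<Union>\<Delta>"

definition simplicial_complex :: "'a set set \<Rightarrow> bool" where
  "simplicial_complex \<Delta> \<longleftrightarrow>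
     finite (vertices \<Delta>) \<and> {} \<in> \<Delta> \<and> (\<forall>f\<in>\<Delta>. \<forall>g. g \<subseteq> f \<longrightarrow> g \<in> \<Delta>)"

definition maximal_face :: "'a set set \<Rightarrow> 'a set \<Rightarrow> bool" where
  "maximal_face \<Delta> f \<longleftrightarrow> f \<in> \<Delta> \<and> (\<forall>g\<in>\<Delta>. f \<subseteq> g \<longrightarrow> g = f)"

text \<open>Dimensions are integers, so that the complex whose only face is the empty set has
  dimension -1.\<close>

definition pure_of_dim :: "int \<Rightarrow> 'a set set \<Rightarrow> bool" where
  "pure_of_dim n \<Delta> \<longleftrightarrow> (\<forall>f. maximal_face \<Delta> f \<longrightarrow> int (card f) = n + 1)"

definition link :: "'a set set \<Rightarrow> 'a set \<Rightarrow> 'a set set" where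
  "link \<Delta> f = {g \<in> \<Delta>. g \<inter> f = {} \<and> g \<union> f \<in> \<Delta>}"

definition minimal_nonface :: "'a set set \<Rightarrow> 'a set \<Rightarrow> bool" where
  "minimal_nonface \<Delta> f \<longleftrightarrow> f \<subseteq> vertices \<Delta> \<and> f \<notin> \<Delta> \<and> (\<forall>g. g \<subset> f \<longrightarrow> g \<in> \<Delta>)"

definition flag :: "'a set set \<Rightarrow> bool" where
  "flag \<Delta> \<longleftrightarrow> (\<forall>f. minimal_nonface \<Delta> f \<longrightarrow> card f = 2)"

definition isomorphic_complexes :: "'a set set \<Rightarrow> 'b set set \<Rightarrow> bool" where
  "isomorphic_complexes \<Delta> \<Delta>' \<longleftrightarrow>
     (\<exists>\<phi>. bij_betw \<phi> (vertices \<Delta>) (vertices \<Delta>') \<and> (\<lambda>f. \<phi> ` f) ` \<Delta> = \<Delta>')"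

text \<open>The join of two complexes lives on the sum type, which makes the vertex sets disjoint.\<close>

definition join :: "'a set set \<Rightarrow> 'b set set \<Rightarrow> ('a + 'b) set set" where
  "join \<Delta>1 \<Delta>2 = {f <+> g | f g. f \<in> \<Delta>1 \<and> g \<in> \<Delta>2}"

definition two_points :: "bool set set" where
  "two_points = {{}, {False}, {True}}"

definition suspension :: "'a set set \<Rightarrow> (bool + 'a) set set" where
  "suspension \<Delta> = join two_points \<Delta>"

text \<open>Only meaningful for \<open>k \<ge> 3\<close>.\<close>

definition cycle_complex :: "nat \<Rightarrow> nat set set" where
  "cycle_complex k = {{}} \<union> {{i} | i. i < k} \<union> {{i, Suc i mod k} | i. i < k}"

section \<open>Reduced simplicial homology over a field\<close>

text \<open>An oriented \<open>i\<close>-chain is represented by the function assigning to an ordering \<open>[x\<^sub>0, \<dots>, x\<^sub>i]\<close>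
  of a face the coefficient of the corresponding oriented simplex. Such functions are exactly the
  ones that vanish off the orderings of \<open>i\<close>-dimensional faces and change sign when two adjacent
  vertices are exchanged, so no choice of a vertex order is involved. The empty list carries the
  (-1)-chains of the augmented complex. As \<open>[y\<^sub>1, \<dots>, y\<^sub>i]\<close> has coefficient 1 in the
  boundary of \<open>[v, y\<^sub>1, \<dots>, y\<^sub>i]\<close>, the usual boundary map becomes summation over the first
  entry.\<close>

definition simplicial_chains :: "int \<Rightarrow> 'a set set \<Rightarrow> ('a list \<Rightarrow> 'k::field) set" where
  "simplicial_chains i \<Delta> =
     {c. (\<forall>xs. c xs \<noteq> 0 \<longrightarrow> distinct xs \<and> set xs \<in> \<Delta> \<and> int (length xs) = i + 1) \<and>
         (\<forall>xs a b ys. c (xs @ a # b # ys) = - c (xs @ b # a # ys))}"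

definition boundary_map :: "'a set set \<Rightarrow> ('a list \<Rightarrow> 'k::field) \<Rightarrow> 'a list \<Rightarrow> 'k" where
  "boundary_map \<Delta> c = (\<lambda>ys. \<Sum>v\<in>vertices \<Delta>. c (v # ys))"

definition simplicial_cycles :: "int \<Rightarrow> 'a set set \<Rightarrow> ('a list \<Rightarrow> 'k::field) set" where
  "simplicial_cycles i \<Delta> = {c \<in> simplicial_chains i \<Delta>. boundary_map \<Delta> c = (\<lambda>_. 0)}"

definition simplicial_boundaries :: "int \<Rightarrow> 'a set set \<Rightarrow> ('a list \<Rightarrow> 'k::field) set" where
  "simplicial_boundaries i \<Delta> = boundary_map \<Delta> ` simplicial_chains (i + 1) \<Delta>"

definition homologous :: "int \<Rightarrow> 'a set set \<Rightarrow> ('a list \<Rightarrow> 'k::field) rel" where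
  "homologous i \<Delta> =
     {(x, y). x \<in> simplicial_cycles i \<Delta> \<and> y \<in> simplicial_cycles i \<Delta> \<and>
              (\<lambda>xs. x xs - y xs) \<in> simplicial_boundaries i \<Delta>}"

definition reduced_homology :: "int \<Rightarrow> 'a set set \<Rightarrow> ('a list \<Rightarrow> 'k::field) set set" where
  "reduced_homology i \<Delta> = simplicial_cycles i \<Delta> // homologous i \<Delta>"

definition homology_class :: "int \<Rightarrow> 'a set set \<Rightarrow> ('a list \<Rightarrow> 'k::field) \<Rightarrow> ('a list \<Rightarrow> 'k) set" where
  "homology_class i \<Delta> x = homologous i \<Delta> `` {x}"

definition reduced_homology_is_zero :: "'k::field itself \<Rightarrow> int \<Rightarrow> 'a set set \<Rightarrow> bool" where
  "reduced_homology_is_zero K i \<Delta> \<longleftrightarrow>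
     (reduced_homology i \<Delta> :: ('a list \<Rightarrow> 'k) set set) = {homology_class i \<Delta> (\<lambda>_. 0)}"

text \<open>Existence of a \<open>K\<close>-linear isomorphism from the homology onto \<open>K\<close>; the vector space
  operations on homology classes are those induced from cycles.\<close>

definition reduced_homology_is_field :: "'k::field itself \<Rightarrow> int \<Rightarrow> 'a set set \<Rightarrow> bool" where
  "reduced_homology_is_field K i \<Delta> \<longleftrightarrow>
     (\<exists>\<phi> :: ('a list \<Rightarrow> 'k) set \<Rightarrow> 'k.
        bij_betw \<phi> (reduced_homology i \<Delta>) UNIV \<and>
        (\<forall>x\<in>simplicial_cycles i \<Delta>. \<forall>y\<in>simplicial_cycles i \<Delta>.
           \<phi> (homology_class i \<Delta> (\<lambda>xs. x xs + y xs)) =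
             \<phi> (homology_class i \<Delta> x) + \<phi> (homology_class i \<Delta> y)) \<and>
        (\<forall>a. \<forall>x\<in>simplicial_cycles i \<Delta>.
           \<phi> (homology_class i \<Delta> (\<lambda>xs. a * x xs)) = a * \<phi> (homology_class i \<Delta> x)))"

definition homology_sphere :: "'k::field itself \<Rightarrow> int \<Rightarrow> 'a set set \<Rightarrow> bool" where
  "homology_sphere K n \<Delta> \<longleftrightarrow>
     simplicial_complex \<Delta> \<and> pure_of_dim n \<Delta> \<and>
     (\<forall>f\<in>\<Delta>. (\<forall>i. i < n - int (card f) \<longrightarrow> reduced_homology_is_zero K i (link \<Delta> f)) \<and>
             reduced_homology_is_field K (n - int (card f)) (link \<Delta> f))"

definition flag_homology_sphere :: "'k::field itself \<Rightarrow> int \<Rightarrow> 'a set set \<Rightarrow> bool" where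
  "flag_homology_sphere K n \<Delta> \<longleftrightarrow> homology_sphere K n \<Delta> \<and> flag \<Delta>"

section \<open>Face enumeration\<close>

definition face_number :: "'a set set \<Rightarrow> nat \<Rightarrow> nat" where
  "face_number \<Delta> i = card {f \<in> \<Delta>. card f = i}"

text \<open>In what follows, \<open>d\<close> is one more than the dimension of \<open>\<Delta>\<close>.\<close>

definition h_poly :: "nat \<Rightarrow> 'a set set \<Rightarrow> int poly" where
  "h_poly d \<Delta> = (\<Sum>i\<le>d. smult (int (face_number \<Delta> i)) ([:-1, 1:] ^ (d - i)))"

text \<open>The expansion below is unique whenever it exists, and it exists when \<open>h_poly d \<Delta>\<close> is
  symmetric (\<open>h\<^sub>i = h\<^bsub>d-i\<^esub>\<close>), as for homology spheres; otherwise the polynomial is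
  unspecified.\<close>

definition gamma_poly :: "nat \<Rightarrow> 'a set set \<Rightarrow> int poly" where
  "gamma_poly d \<Delta> =
     (THE \<gamma>. degree \<gamma> \<le> d div 2 \<and>
        h_poly d \<Delta> = (\<Sum>i\<le>d div 2. smult (coeff \<gamma> i) (monom 1 i * [:1, 1:] ^ (d - 2 * i))))"

definition antipodes :: "'a set set \<Rightarrow> 'a \<Rightarrow> 'a set" where
  "antipodes \<Delta> v = {w \<in> vertices \<Delta>. w \<noteq> v \<and> {v, w} \<notin> \<Delta>}"

definition num_antipodes :: "'a set set \<Rightarrow> 'a \<Rightarrow> nat" where
  "num_antipodes \<Delta> v = card (antipodes \<Delta> v)"

definition polar_size :: "'a set set \<Rightarrow> nat" where
  "polar_size \<Delta> = Min (num_antipodes \<Delta> ` vertices \<Delta>)"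

end

theory Submission
  imports Defs "HOL-Library.Function_Algebras"
begin

text \<open>A flag complex is determined by its graph, and the only topology needed from a homology
  sphere for the isomorphisms is that links of codimension one faces are two points and links of
  smaller faces are connected. In such a graph every vertex has an antipode, and a vertex \<open>a\<close> with a
  unique antipode \<open>b\<close> makes the graph the suspension of the neighbourhood of \<open>a\<close>.

  If \<open>v0\<close> has the fewest antipodes and its link is the suspension of \<open>\<Gamma>\<close> with poles \<open>a, b\<close>, then
  counting antipodes of \<open>a\<close> shows that \<open>a\<close> has at most two neighbours outside \<open>\<Gamma>\<close>, hence exactly
  two, and its link is again a suspension of \<open>\<Gamma>\<close>. Continuing from neighbour to neighbour traces out
  a cycle joined to \<open>\<Gamma>\<close>, which must be everything. In part (ii) the hypothesis says that the link of
  \<open>v0\<close> has \<open>2(d-1)+1\<close> vertices, and a count of antipodes gives it a vertex with a unique antipode,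
  so the same argument applies; doing this once more in \<open>\<Gamma>\<close> would give \<open>\<Delta>\<close> a vertex with a single
  antipode unless \<open>d = 4\<close>.

  The \<open>\<gamma>\<close>-polynomial exists by the Dehn-Sommerville relations, which follow from the Euler
  characteristics of the links, and it is multiplicative under the join with a cycle.\<close>

section \<open>Graphs of flag pseudomanifolds\<close>

locale sgraph =
  fixes E :: "'a \<Rightarrow> 'a \<Rightarrow> bool"
  assumes sym: "E x y \<Longrightarrow> E y x" and irrefl: "\<not> E x x"
begin

definition nbrs :: "'a set \<Rightarrow> 'a \<Rightarrow> 'a set" where
  "nbrs V v = {w \<in> V. E v w}"

definition nonnbrs :: "'a set \<Rightarrow> 'a \<Rightarrow> 'a set" where
  "nonnbrs V v = {w \<in> V. w \<noteq> v \<and> \<not> E v w}"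

text \<open>Edge-closed subsets replace paths, so that connectedness applies directly to a set grown
  step by step. The empty set counts as connected, hence the separate nonemptiness in
  \<open>npm\<close>.\<close>

definition connected_on :: "'a set \<Rightarrow> bool" where
  "connected_on V \<longleftrightarrow>
     (\<forall>U \<subseteq> V. U \<noteq> {} \<longrightarrow> (\<forall>u\<in>U. \<forall>w\<in>V. E u w \<longrightarrow> w \<in> U) \<longrightarrow> U = V)"

text \<open>\<open>npm d V\<close> says that the clique complex of the graph induced on \<open>V\<close> is a normal pseudomanifold
  of dimension \<open>d - 1\<close>.\<close>

fun npm :: "nat \<Rightarrow> 'a set \<Rightarrow> bool" where
  "npm 0 V \<longleftrightarrow> V = {}"
| "npm (Suc 0) V \<longleftrightarrow> (\<exists>a b. a \<noteq> b \<and> \<not> E a b \<and> V = {a, b})"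
| "npm (Suc (Suc d)) V \<longleftrightarrow> V \<noteq> {} \<and> connected_on V \<and> (\<forall>v\<in>V. npm (Suc d) (nbrs V v))"

lemma connected_onD:
  assumes "connected_on V" "U \<subseteq> V" "U \<noteq> {}" "\<And>u w. u \<in> U \<Longrightarrow> w \<in> V \<Longrightarrow> E u w \<Longrightarrow> w \<in> U"
  shows "U = V"
  using assms unfolding connected_on_def by blast

lemma nbrs_subset: "nbrs V v \<subseteq> V"
  by (auto simp: nbrs_def)

section \<open>Counting neighbours and antipodes\<close>

lemma card_eq_nbrs_nonnbrs:
  assumes "finite V" "v \<in> V"
  shows "card V = 1 + card (nbrs V v) + card (nonnbrs V v)"
proof -
  have V: "V = insert v (nbrs V v \<union> nonnbrs V v)"
    using assms(2) by (auto simp: nbrs_def nonnbrs_def)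
  have "card (nbrs V v \<union> nonnbrs V v) = card (nbrs V v) + card (nonnbrs V v)"
    using assms(1) by (intro card_Un_disjoint) (auto simp: nbrs_def nonnbrs_def)
  moreover have "v \<notin> nbrs V v \<union> nonnbrs V v" "finite (nbrs V v \<union> nonnbrs V v)"
    using assms(1) irrefl by (auto simp: nbrs_def nonnbrs_def)
  ultimately show ?thesis
    by (subst V) simp
qed

lemma npm_nbrs:
  assumes "npm (Suc d) V" "v \<in> V"
  shows "npm d (nbrs V v)"
  using assms sym irrefl by (cases d) (auto simp: nbrs_def)

lemma npm_nonempty: "npm (Suc d) V \<Longrightarrow> V \<noteq> {}"
  by (cases d) auto

text \<open>Induction on \<open>d\<close> through a neighbour \<open>u\<close> of \<open>v\<close>:
  the link of \<open>u\<close> has smaller dimension and contains \<open>v\<close>, and an antipode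
  of \<open>v\<close> inside it is an antipode in \<open>V\<close>.\<close>

lemma nonnbrs_nonempty:
  assumes "npm d V" "v \<in> V"
  shows "nonnbrs V v \<noteq> {}"
  using assms
proof (induction d V arbitrary: v rule: npm.induct)
  case (2 V)
  then show ?case using sym by (fastforce simp: nonnbrs_def)
next
  case (3 d V)
  have "npm (Suc d) (nbrs V v)" using 3 by auto
  then obtain u where u: "u \<in> V" "E v u"
    using npm_nonempty by (auto simp: nbrs_def)
  then have "v \<in> nbrs V u" "npm (Suc d) (nbrs V u)"
    using 3 sym by (auto simp: nbrs_def)
  then have "nonnbrs (nbrs V u) v \<noteq> {}" using 3(1)[OF u(1)] by blast
  then show ?case by (auto simp: nonnbrs_def nbrs_def)
qed simp

text \<open>The apex of a link and one antipode of the apex raise the bound by two per dimension;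
  the cross-polytope attains it.\<close>

lemma card_npm_ge:
  assumes "npm d V" "finite V"
  shows "2 * d \<le> card V"
  using assms
proof (induction d V rule: npm.induct)
  case (3 d V)
  then obtain v where v: "v \<in> V" by auto
  have "2 * Suc d \<le> card (nbrs V v)"
    using 3 v finite_subset[OF nbrs_subset] by auto
  moreover have "card (nonnbrs V v) \<ge> 1"
    using nonnbrs_nonempty[OF 3(2) v] \<open>finite V\<close>
    by (simp add: Suc_leI card_gt_0_iff nonnbrs_def)
  ultimately show ?case using card_eq_nbrs_nonnbrs[OF \<open>finite V\<close> v] by simp
qed auto

text \<open>\<open>a\<close> must have an antipode inside the link of its neighbour
  \<open>g\<close>, and \<open>b\<close> is the only candidate. Hence \<open>V\<close> is the
  suspension of \<open>nbrs V a\<close> with poles \<open>a\<close> and \<open>b\<close>.\<close>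

lemma unique_nonnbr_adjacent:
  assumes "npm (Suc d) V" "a \<in> V" "nonnbrs V a = {b}" "g \<in> nbrs V a"
  shows "E g b"
proof -
  have "npm d (nbrs V g)" "a \<in> nbrs V g"
    using assms npm_nbrs sym by (auto simp: nbrs_def)
  then obtain w where "w \<in> nonnbrs (nbrs V g) a" using nonnbrs_nonempty by blast
  then have "w \<in> nonnbrs V a" "E g w" by (auto simp: nonnbrs_def nbrs_def)
  then show ?thesis using assms(3) by auto
qed

text \<open>The hypotheses control only the neighbours of \<open>U\<close>. For \<open>g\<close> in
  \<open>A\<close>, induction applied to the link of \<open>g\<close>, with \<open>nbrs A g\<close>
  in place of \<open>A\<close>, controls those of \<open>g\<close>; then \<open>A \<union> U\<close>
  is edge-closed and connectedness finishes. Two points in \<open>U\<close> are demanded because for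
  \<open>d = 1\<close> they must fill \<open>V\<close>.\<close>

lemma join_exhausts_npm:
  assumes "npm d V" "A \<subseteq> V" "U \<subseteq> V" "x \<in> U" "y \<in> U" "x \<noteq> y"
    and "\<And>g u. g \<in> A \<Longrightarrow> u \<in> U \<Longrightarrow> E g u"
    and "\<And>u. u \<in> U \<Longrightarrow> nbrs V u \<subseteq> A \<union> U"
  shows "V = A \<union> U"
  using assms
proof (induction d V arbitrary: A rule: npm.induct)
  case (2 V)
  then obtain a b where "V = {a, b}" by auto
  then have "V \<subseteq> U" using \<open>U \<subseteq> V\<close> \<open>x \<in> U\<close> \<open>y \<in> U\<close> \<open>x \<noteq> y\<close> by blast
  then show ?case using \<open>A \<subseteq> V\<close> \<open>U \<subseteq> V\<close> by blast
next
  case (3 d V)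
  have "nbrs V g \<subseteq> A \<union> U" if g: "g \<in> A" for g
  proof -
    have "nbrs V g = nbrs A g \<union> U"
    proof (rule 3(1))
      show "g \<in> V" "npm (Suc d) (nbrs V g)" using 3 g by auto
      show "U \<subseteq> nbrs V g" using 3 g by (auto simp: nbrs_def)
      show "E h u" if "h \<in> nbrs A g" "u \<in> U" for h u
        using 3(8) that by (auto simp: nbrs_def)
      show "nbrs (nbrs V g) u \<subseteq> nbrs A g \<union> U" if "u \<in> U" for u
        using 3(9)[OF that] by (auto simp: nbrs_def)
    qed (use 3 in \<open>auto simp: nbrs_def\<close>)
    then show ?thesis by (auto simp: nbrs_def)
  qed
  then have closed: "w \<in> A \<union> U" if "u \<in> A \<union> U" "w \<in> V" "E u w" for u w
    using 3(9) that unfolding nbrs_def by blast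
  have "A \<union> U = V"
    by (rule connected_onD) (use 3 closed in auto)
  then show ?case by simp
qed auto

text \<open>Otherwise every vertex has exactly two antipodes and a link with as few vertices as a
  cross-polytope. Each \<open>u\<close> in the link of \<open>v\<close> then has an antipode among
  the two antipodes of \<open>v\<close>, and each of these can serve only one \<open>u\<close>. So
  the link has at most two vertices, against \<open>d \<ge> 3\<close>; the pentagon shows that
  \<open>d = 2\<close> fails.\<close>

lemma vertex_with_unique_nonnbr:
  assumes "npm d V" "finite V" "card V = 2 * d + 1" "d \<ge> 3"
  shows "\<exists>a\<in>V. \<exists>b. nonnbrs V a = {b}"
proof (rule ccontr)
  assume no: "\<not> ?thesis"
  obtain e where e: "d = Suc (Suc e)" "e \<ge> 1"
    using assms(4) by (metis Suc_le_D add_2_eq_Suc le_add_diff_inverse numeral_3_eq_3 One_nat_def Suc_le_mono)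
  have fin: "finite (nonnbrs V v)" "finite (nbrs V v)" for v
    using assms(2) by (auto simp: nonnbrs_def nbrs_def)
  have nb: "npm (Suc e) (nbrs V v)" if "v \<in> V" for v
    using assms(1) that npm_nbrs unfolding e by blast
  \<comment> \<open>Besides \<open>v\<close> there are \<open>2 * d\<close> vertices; at least
    \<open>2 * (d - 1)\<close> of them are neighbours and at least two are antipodes, so both bounds
    are attained.\<close>
  have two: "card (nonnbrs V v) = 2 \<and> card (nbrs V v) = 2 * Suc e" if "v \<in> V" for v
  proof -
    have "card (nonnbrs V v) \<noteq> 0" "card (nonnbrs V v) \<noteq> 1"
      using nonnbrs_nonempty[OF assms(1) that] no that fin by (auto simp: card_1_singleton_iff)
    moreover have "card (nbrs V v) \<ge> 2 * Suc e"
      using card_npm_ge[OF nb[OF that]] fin by auto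
    ultimately show ?thesis
      using card_eq_nbrs_nonnbrs[OF assms(2) that] assms(3) e by simp
  qed
  obtain v where v: "v \<in> V" using assms(1) npm_nonempty e by blast
  obtain x y where xy: "nonnbrs V v = {x, y}" "x \<noteq> y"
    using two[OF v] by (auto simp: card_2_iff)
  \<comment> \<open>One of the two antipodes of \<open>x\<close> is \<open>v\<close> itself, which
    lies outside its own link.\<close>
  have half: "card (nonnbrs V x \<inter> nbrs V v) \<le> 1" if "x \<in> nonnbrs V v" for x
  proof -
    have "v \<in> nonnbrs V x" "x \<in> V" using that v sym by (auto simp: nonnbrs_def)
    then have "card (nonnbrs V x - {v}) = 1" using two fin by simp
    moreover have "nonnbrs V x \<inter> nbrs V v \<subseteq> nonnbrs V x - {v}"
      using irrefl by (auto simp: nbrs_def)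
    ultimately show ?thesis using fin by (metis card_mono finite_Diff)
  qed
  have "nbrs V v \<subseteq> (nonnbrs V x \<inter> nbrs V v) \<union> (nonnbrs V y \<inter> nbrs V v)"
  proof
    fix u assume u: "u \<in> nbrs V v"
    then have uV: "u \<in> V" by (simp add: nbrs_def)
    have vu: "v \<in> nbrs V u" using u v sym by (auto simp: nbrs_def)
    have "card (nonnbrs (nbrs V v) u) = 1"
    proof -
      have "npm e (nbrs (nbrs V v) u)" using nb[OF v] u npm_nbrs by blast
      then have "2 * e \<le> card (nbrs (nbrs V v) u)"
        using card_npm_ge finite_subset[OF nbrs_subset fin(2)] by blast
      moreover have "nonnbrs (nbrs V v) u \<noteq> {}"
        using nonnbrs_nonempty nb[OF v] u by blast
      then have "card (nonnbrs (nbrs V v) u) \<noteq> 0" using fin by (auto simp: nonnbrs_def)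
      ultimately show ?thesis
        using card_eq_nbrs_nonnbrs[OF fin(2) u] two[OF v] by simp
    qed
    moreover have "nonnbrs (nbrs V v) u = nonnbrs V u \<inter> nbrs V v"
      by (auto simp: nonnbrs_def nbrs_def)
    \<comment> \<open>Of the two antipodes of \<open>u\<close> only one lies in the link of
      \<open>v\<close>; the other is not \<open>v\<close>, hence it is an antipode of
      \<open>v\<close>.\<close>
    ultimately have "\<not> nonnbrs V u \<subseteq> nbrs V v"
      using two[OF uV] by (metis Int_absorb2 one_eq_numeral_iff semiring_norm(83) one_neq_zero num.distinct(1))
    then obtain w where w: "w \<in> nonnbrs V u" "w \<notin> nbrs V v" by auto
    then have "w \<in> nonnbrs V v"
      using vu by (auto simp: nonnbrs_def nbrs_def)
    moreover have "u \<in> nonnbrs V w" using w uV sym by (auto simp: nonnbrs_def)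
    ultimately show "u \<in> (nonnbrs V x \<inter> nbrs V v) \<union> (nonnbrs V y \<inter> nbrs V v)"
      using xy u by auto
  qed
  then have "card (nbrs V v) \<le> card (nonnbrs V x \<inter> nbrs V v) + card (nonnbrs V y \<inter> nbrs V v)"
    by (meson card_Un_le card_mono fin finite_Int finite_Un le_trans)
  also have "\<dots> \<le> 2" using half[of x] half[of y] xy by simp
  finally show False using two[OF v] e by simp
qed

section \<open>Splitting off a circle\<close>

text \<open>Nonadjacency of \<open>x\<close> and \<open>y\<close> rules out triangles; it is what
  \<open>npm\<close> yields for the vertex links of a one-dimensional complex.\<close>

definition two_regular :: "'a set \<Rightarrow> bool" where
  "two_regular C \<longleftrightarrow> (\<forall>c\<in>C. \<exists>x y. x \<noteq> y \<and> \<not> E x y \<and> nbrs C c = {x, y})"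

text \<open>Since \<open>card V = card A + card (nonnbrs V v0) + 3\<close>, minimality of
  \<open>v0\<close> bounds every degree by \<open>card A + 2\<close>. A vertex of \<open>C\<close>
  adjacent to all of \<open>A\<close> thus has at most two neighbours in \<open>C\<close>: if
  \<open>w\<close> is one, the antipode of \<open>w\<close> in the link is the other. This passes
  from \<open>v0\<close> along the edges of \<open>C\<close>, and \<open>join_exhausts_npm\<close>
  shows that it reaches all of \<open>C\<close>.\<close>

lemma circle_factor:
  assumes V: "npm d V" "finite V"
    and v0: "v0 \<in> V" "\<And>v. v \<in> V \<Longrightarrow> card (nonnbrs V v0) \<le> card (nonnbrs V v)"
    and a: "a \<in> nbrs V v0" "nonnbrs (nbrs V v0) a = {b}"
  defines "A \<equiv> nbrs (nbrs V v0) a"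
  defines "C \<equiv> V - A"
  shows "\<And>g c. g \<in> A \<Longrightarrow> c \<in> C \<Longrightarrow> E g c" "two_regular C" "connected_on C"
    "card C = card (nonnbrs V v0) + 3"
proof -
  have finA: "finite A" and AV: "A \<subseteq> V" using V by (auto simp: A_def nbrs_def)
  have "d \<noteq> 0"
  proof
    assume "d = 0"
    with V(1) v0(1) show False by simp
  qed
  moreover have "d \<noteq> Suc 0" using npm_nbrs[of 0 V v0] V v0 a by auto
  ultimately obtain e where e: "d = Suc (Suc e)" by (metis not0_implies_Suc)
  have link: "npm (Suc e) (nbrs V v0)" using V v0 npm_nbrs unfolding e by blast
  have b: "b \<in> nbrs V v0" "b \<noteq> a" "\<not> E a b" using a by (auto simp: nonnbrs_def)
  have Ab: "E g b" if "g \<in> A" for g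
    using unique_nonnbr_adjacent[OF link a] that by (simp add: A_def)
  have N0: "nbrs V v0 = A \<union> {a, b}"
    using a b unfolding A_def nbrs_def nonnbrs_def by fast
  have abA: "a \<notin> A" "b \<notin> A" "v0 \<notin> A"
    using b irrefl by (auto simp: A_def nbrs_def)
  have cardN0: "card (nbrs V v0) = card A + 2"
    unfolding N0 using abA b finA by simp
  have cardV: "card V = card A + card (nonnbrs V v0) + 3"
    using card_eq_nbrs_nonnbrs[OF V(2) v0(1)] cardN0 by simp
  then show cardC: "card C = card (nonnbrs V v0) + 3"
    unfolding C_def using finA AV by (simp add: card_Diff_subset)
  \<comment> \<open>\<open>U\<close> collects the vertices of \<open>C\<close> whose link is known
    to be a suspension over \<open>A\<close>; the poles are recorded as adjacent to \<open>A\<close>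
    so that \<open>step\<close> can carry the property to them.\<close>
  define U where "U = {w \<in> C. (\<forall>g\<in>A. E g w) \<and>
    (\<exists>x y. x \<noteq> y \<and> \<not> E x y \<and> x \<in> C \<and> y \<in> C \<and> (\<forall>g\<in>A. E g x \<and> E g y) \<and> nbrs V w = A \<union> {x, y})}"
  have aC: "a \<in> C" "b \<in> C" "v0 \<in> C"
    using a b v0 abA by (auto simp: C_def nbrs_def)
  have "v0 \<in> U"
    unfolding U_def using aC N0 b Ab by (auto simp: A_def nbrs_def intro: sym)
  have step: "x \<in> U" if w: "w \<in> U" and x: "x \<in> C" "E w x" for w x
  proof -
    have "\<exists>y. x \<noteq> y \<and> \<not> E x y \<and> y \<in> C \<and> (\<forall>g\<in>A. E g x \<and> E g y) \<and> nbrs V w = A \<union> {x, y}"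
    proof -
      from w obtain x' y' where *: "x' \<noteq> y'" "\<not> E x' y'" "x' \<in> C" "y' \<in> C"
        "\<forall>g\<in>A. E g x' \<and> E g y'" "nbrs V w = A \<union> {x', y'}" unfolding U_def by blast
      have "x \<in> nbrs V w" using x by (auto simp: nbrs_def C_def)
      then have "x = x' \<or> x = y'" using * x by (auto simp: C_def)
      then show ?thesis
        using * sym by (elim disjE) (blast, metis insert_commute)
    qed
    then obtain y where y: "x \<noteq> y" "\<not> E x y" "y \<in> C" "\<forall>g\<in>A. E g x \<and> E g y"
      "nbrs V w = A \<union> {x, y}" by blast
    have xV: "x \<in> V" and wV: "w \<in> C" "w \<in> V" "\<forall>g\<in>A. E g w"
      using x w by (auto simp: C_def U_def)
    have sub: "insert w A \<subseteq> nbrs V x" using x y AV wV sym by (auto simp: nbrs_def)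
    have "npm (Suc e) (nbrs V x)" using V xV npm_nbrs unfolding e by blast
    \<comment> \<open>The antipode \<open>z\<close> of \<open>w\<close> in the link of
      \<open>x\<close> is the second neighbour of \<open>x\<close> in \<open>C\<close>.\<close>
    then obtain z where z: "z \<in> nonnbrs (nbrs V x) w"
      using nonnbrs_nonempty sub by blast
    have "z \<notin> A" using z wV sym by (auto simp: nonnbrs_def)
    have "z \<noteq> w" "\<not> E w z" "z \<in> C" using z \<open>z \<notin> A\<close> by (auto simp: nonnbrs_def C_def nbrs_def)
    have sub': "A \<union> {w, z} \<subseteq> nbrs V x" using sub z by (auto simp: nonnbrs_def)
    have "card (A \<union> {w, z}) = card A + 2"
      using \<open>z \<notin> A\<close> \<open>z \<noteq> w\<close> wV finA by (auto simp: C_def)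
    \<comment> \<open>The degree bound: \<open>x\<close> has at least as many antipodes as
      \<open>v0\<close>.\<close>
    moreover have "card (nbrs V x) \<le> card A + 2"
      using card_eq_nbrs_nonnbrs[OF V(2) xV] v0(2)[OF xV] cardV by linarith
    ultimately have N: "nbrs V x = A \<union> {w, z}"
      using sub' V(2) by (metis card_seteq finite_subset nbrs_subset)
    have "nonnbrs (nbrs V x) w = {z}"
      using N wV sym \<open>z \<noteq> w\<close> \<open>\<not> E w z\<close> by (auto simp: nonnbrs_def)
    moreover have "w \<in> nbrs V x" "A \<subseteq> nbrs (nbrs V x) w"
      using sub wV sym by (auto simp: nbrs_def)
    \<comment> \<open>Now \<open>z\<close> is the only antipode of \<open>w\<close> in this link, so
      all of \<open>A\<close> is joined to it.\<close>
    ultimately have "\<forall>g\<in>A. E g z"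
      using unique_nonnbr_adjacent[OF \<open>npm (Suc e) (nbrs V x)\<close>] by blast
    then have "w \<noteq> z \<and> \<not> E w z \<and> w \<in> C \<and> z \<in> C \<and> (\<forall>g\<in>A. E g w \<and> E g z) \<and> nbrs V x = A \<union> {w, z}"
      using wV N \<open>z \<noteq> w\<close> \<open>\<not> E w z\<close> \<open>z \<in> C\<close> by simp
    moreover have "\<forall>g\<in>A. E g x" using y by blast
    ultimately show ?thesis
      unfolding U_def using x(1) by (intro CollectI conjI exI[of _ w] exI[of _ z]) simp_all
  qed
  \<comment> \<open>With \<open>W = U\<close> this gives \<open>C = U\<close>; for arbitrary
    edge-closed \<open>W\<close> it then gives the connectedness of \<open>C\<close>.\<close>
  have closed: "C = W" if W: "W \<subseteq> U" "w \<in> W" "\<And>u x. u \<in> W \<Longrightarrow> x \<in> C \<Longrightarrow> E u x \<Longrightarrow> x \<in> W" for W w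
  proof -
    obtain x where x: "x \<in> C" "E w x" using W unfolding U_def nbrs_def by blast
    have "V = A \<union> W"
    proof (rule join_exhausts_npm[OF V(1)])
      show "w \<in> W" "x \<in> W" "w \<noteq> x" using W x irrefl by auto
      show "nbrs V u \<subseteq> A \<union> W" if "u \<in> W" for u
        using W that by (auto simp: C_def nbrs_def)
    qed (use W AV in \<open>auto simp: U_def C_def\<close>)
    moreover have "W \<inter> A = {}" using W by (auto simp: U_def C_def)
    ultimately show ?thesis unfolding C_def by auto
  qed
  have CU: "C = U" using closed[of U v0] \<open>v0 \<in> U\<close> step by blast
  then show "E g c" if "g \<in> A" "c \<in> C" for g c using that unfolding U_def by blast
  show "two_regular C"
    unfolding two_regular_def
  proof
    fix c assume "c \<in> C"
    then obtain x y where "x \<noteq> y" "\<not> E x y" "x \<in> C" "y \<in> C" "nbrs V c = A \<union> {x, y}"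
      using CU unfolding U_def by blast
    moreover from this have "nbrs C c = {x, y}"
      by (auto simp: nbrs_def C_def)
    ultimately show "\<exists>x y. x \<noteq> y \<and> \<not> E x y \<and> nbrs C c = {x, y}" by blast
  qed
  show "connected_on C"
    unfolding connected_on_def using closed CU by blast
qed

text \<open>Walk along edges without turning back. The first repeated vertex must be the starting
  one, and the visited set is edge-closed, so it is all of \<open>C\<close>.\<close>

lemma two_regular_connected_is_cycle:
  assumes "finite C" "C \<noteq> {}" "two_regular C" "connected_on C"
  obtains p where "bij_betw p {..<card C} C"
    "\<And>i. i < card C \<Longrightarrow> nbrs C (p i) = {p (Suc i mod card C), p ((i + card C - 1) mod card C)}"
proof -
  \<comment> \<open>Only meaningful if \<open>u\<close> is a neighbour of \<open>v\<close>; then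
    two-regularity makes the choice unique.\<close>
  define other where "other u v = (SOME w. w \<noteq> u \<and> w \<in> nbrs C v)" for u v
  have other: "nbrs C v = {u, other u v} \<and> other u v \<noteq> u \<and> other u v \<in> C" if "u \<in> nbrs C v" "v \<in> C" for u v
  proof -
    obtain x y where xy: "x \<noteq> y" "nbrs C v = {x, y}"
      using assms(3) \<open>v \<in> C\<close> unfolding two_regular_def by blast
    then have "\<exists>w. w \<noteq> u \<and> w \<in> nbrs C v" by auto
    from someI_ex[OF this] have "other u v \<noteq> u \<and> other u v \<in> nbrs C v" unfolding other_def .
    then show ?thesis using xy that by (auto simp: nbrs_def)
  qed
  obtain v where v: "v \<in> C" using assms by auto
  obtain w where w: "w \<in> nbrs C v" using assms(3) v unfolding two_regular_def by blast
  \<comment> \<open>The state of the walk is a directed edge, so that the next vertex can avoid the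
    previous one.\<close>
  define q where "q n = ((\<lambda>(x, y). (y, other x y)) ^^ n) (v, w)" for n
  define p where "p n = fst (q n)" for n
  have q: "q n = (p n, p (Suc n))" for n
    by (simp add: p_def q_def split: prod.split)
  have p0: "p 0 = v" "p (Suc 0) = w" by (simp_all add: p_def q_def)
  have p_Suc: "p (Suc (Suc n)) = other (p n) (p (Suc n))" for n
  proof -
    have "q (Suc n) = (\<lambda>(x, y). (y, other x y)) (q n)" by (simp add: q_def)
    then have "q (Suc n) = (p (Suc n), other (p n) (p (Suc n)))" by (simp add: q[of n])
    then show ?thesis using q[of "Suc n"] by simp
  qed
  have path: "p n \<in> C \<and> p (Suc n) \<in> C \<and> E (p n) (p (Suc n))" for n
  proof (induction n)
    case 0
    then show ?case using p0 v w by (auto simp: nbrs_def)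
  next
    case (Suc n)
    then have "p n \<in> nbrs C (p (Suc n))" using sym by (auto simp: nbrs_def)
    from other[OF this] Suc show ?case by (auto simp: p_Suc nbrs_def)
  qed
  have nb: "nbrs C (p (Suc n)) = {p n, p (Suc (Suc n))}" "p (Suc (Suc n)) \<noteq> p n" for n
  proof -
    have "p n \<in> nbrs C (p (Suc n))" using path[of n] sym by (auto simp: nbrs_def)
    from other[OF this] path[of n]
    show "nbrs C (p (Suc n)) = {p n, p (Suc (Suc n))}" "p (Suc (Suc n)) \<noteq> p n"
      by (simp_all add: p_Suc)
  qed
  define m where "m = (LEAST m. \<exists>j<m. p m = p j)"
  have "\<exists>m. \<exists>j<m. p m = p j"
  proof (rule ccontr)
    assume "\<not> ?thesis"
    then have "inj p" by (metis injI linorder_neqE_nat)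
    moreover have "range p \<subseteq> C" using path by auto
    ultimately show False using assms(1) finite_subset finite_imageD by blast
  qed
  from LeastI_ex[OF this] obtain j where j: "j < m" "p m = p j" unfolding m_def by blast
  have inj: "inj_on p {..<m}"
  proof (rule inj_onI, rule ccontr)
    fix x y assume "x \<in> {..<m}" "y \<in> {..<m}" "p x = p y" "x \<noteq> y"
    then show False
      using not_less_Least[of x "\<lambda>m. \<exists>j<m. p m = p j"]
        not_less_Least[of y "\<lambda>m. \<exists>j<m. p m = p j"]
      unfolding m_def[symmetric] by (metis lessThan_iff linorder_neqE_nat)
  qed
  obtain k where k: "m = Suc k" using j by (cases m) auto
  \<comment> \<open>If the walk first returned to \<open>p j\<close> with \<open>j > 0\<close>, its
    predecessor \<open>p k\<close> would be a neighbour of \<open>p j\<close>, hence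
    \<open>p (j - 1)\<close> or \<open>p (j + 1)\<close>. Both contradict the minimality of
    \<open>m\<close>, except that \<open>j + 1 = m\<close> gives a loop and \<open>j + 2 = m\<close>
    a step straight back.\<close>
  have "j = 0"
  proof (rule ccontr)
    assume "j \<noteq> 0"
    then obtain i where i: "j = Suc i" by (cases j) auto
    have "p k \<in> nbrs C (p j)"
      using path[of k] j k sym by (auto simp: nbrs_def)
    then consider "p k = p i" | "p k = p (Suc j)" using nb(1)[of i] i by auto
    then show False
    proof cases
      case 1
      then show False using inj_onD[OF inj 1] i j k by auto
    next
      case 2
      show False
      proof (cases "Suc j = m")
        case True
        then show False using path[of j] j irrefl by metis
      next
        case False
        then have "k = Suc j" using inj_onD[OF inj 2] j k by auto
        then show False using nb(2)[of j] j k by simp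
      qed
    qed
  qed
  then have pm: "p m = p 0" using j by simp
  have "k \<noteq> 0"
  proof
    assume "k = 0"
    then have "p (Suc 0) = p 0" using pm k by simp
    then show False using path[of 0] irrefl by metis
  qed
  have "k \<noteq> 1" using nb(2)[of 0] pm k by auto
  then have k2: "k \<ge> 2" using \<open>k \<noteq> 0\<close> by simp
  have nb0: "nbrs C (p 0) = {p 1, p k}"
  proof -
    have "p 1 \<in> nbrs C (p 0)" using path[of 0] by (auto simp: nbrs_def)
    from other[OF this] path[of 0]
    have "nbrs C (p 0) = {p 1, other (p 1) (p 0)}" by auto
    moreover have "p k \<in> nbrs C (p 0)" using path[of k] pm k sym by (auto simp: nbrs_def)
    moreover have "p k \<noteq> p 1" using inj_onD[OF inj, of k 1] k k2 by auto
    ultimately show ?thesis by auto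
  qed
  have nbm: "nbrs C (p i) = {p (Suc i mod m), p ((i + m - 1) mod m)}" if "i < m" for i
  proof (cases i)
    case 0
    then show ?thesis using nb0 k k2 by simp
  next
    case (Suc i')
    have "p (Suc i mod m) = p (Suc i)" using that pm by (cases "Suc i = m") auto
    moreover have "(i + m - 1) mod m = i'" using Suc that by simp
    ultimately show ?thesis using nb(1)[of i'] Suc by auto
  qed
  have "p ` {..<m} = C"
  proof (rule connected_onD[OF assms(4)])
    fix u w assume "u \<in> p ` {..<m}" "w \<in> C" "E u w"
    then obtain i where i: "i < m" "w \<in> nbrs C (p i)" by (auto simp: nbrs_def)
    have "0 < m" using k by simp
    then show "w \<in> p ` {..<m}"
      using nbm[OF i(1)] i(2) by auto
  qed (use path k in auto)
  then have bij: "bij_betw p {..<m} C" using inj by (simp add: bij_betw_def)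
  then have "card C = m" using bij_betw_same_card by fastforce
  then show thesis using that[of p] bij nbm by simp
qed

end

section \<open>The gamma polynomial\<close>

text \<open>The sum from the definition of \<open>gamma_poly\<close>, isolated so that it can be
  treated as a linear function of \<open>\<gamma>\<close>.\<close>

definition gamma_expansion :: "nat \<Rightarrow> int poly \<Rightarrow> int poly" where
  "gamma_expansion d \<gamma> =
     (\<Sum>i\<le>d div 2. smult (coeff \<gamma> i) (monom 1 i * [:1, 1:] ^ (d - 2 * i)))"

text \<open>Splitting off the constant coefficient lowers \<open>d\<close> by two; existence and
  uniqueness of the expansion are proved by induction along this recursion.\<close>

lemma gamma_expansion_pCons:
  "gamma_expansion (Suc (Suc d)) (pCons a \<gamma>) =
     smult a ([:1, 1:] ^ Suc (Suc d)) + pCons 0 (gamma_expansion d \<gamma>)"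
proof -
  have "smult c (monom 1 (Suc i) * q) = pCons 0 (smult c (monom 1 i * q))" for c i and q :: "int poly"
    by (simp add: monom_Suc)
  moreover have "(\<Sum>i\<in>A. pCons 0 (g i)) = pCons 0 (\<Sum>i\<in>A. g i)" for A :: "nat set" and g :: "nat \<Rightarrow> int poly"
    by (induction A rule: infinite_finite_induct) auto
  ultimately show ?thesis
    unfolding gamma_expansion_def by (simp add: sum.atMost_Suc_shift del: power_Suc sum.atMost_Suc)
qed

lemma gamma_expansion_add:
  "gamma_expansion d (\<gamma> + \<delta>) = gamma_expansion d \<gamma> + gamma_expansion d \<delta>"
  by (simp add: gamma_expansion_def smult_add_left sum.distrib)

lemma gamma_expansion_smult:
  "gamma_expansion d (smult c \<gamma>) = smult c (gamma_expansion d \<gamma>)"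
proof -
  have "smult c (sum f A) = (\<Sum>i\<in>A. smult c (f i))" for f :: "nat \<Rightarrow> int poly" and A
    by (induction A rule: infinite_finite_induct) (auto simp: smult_add_right)
  then show ?thesis by (simp add: gamma_expansion_def)
qed

lemma gamma_expansion_small: "d < 2 \<Longrightarrow> gamma_expansion d \<gamma> = smult (coeff \<gamma> 0) ([:1, 1:] ^ d)"
  by (simp add: gamma_expansion_def)

lemma coeff_one_plus_power: "coeff ([:1, 1:] ^ d) i = (of_nat (d choose i) :: int)"
proof (cases "i \<le> d")
  case False
  then have "degree ([:1, 1:] ^ d :: int poly) < i"
    using degree_linear_power[of 1 d] by (metis not_le)
  then show ?thesis using False by (simp add: coeff_eq_0 binomial_eq_0)
qed (simp add: coeff_linear_poly_power)

text \<open>Subtracting \<open>coeff p 0\<close> times \<open>(1 + t)^d\<close> keeps the symmetry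
  and kills the constant coefficient, hence also that of \<open>t^d\<close>. What remains is
  \<open>t\<close> times a polynomial symmetric for \<open>d - 2\<close>.\<close>

lemma ex_gamma_expansion:
  assumes "degree p \<le> d" "\<And>i. i \<le> d \<Longrightarrow> coeff p i = coeff p (d - i)"
  shows "\<exists>\<gamma>. degree \<gamma> \<le> d div 2 \<and> p = gamma_expansion d \<gamma>"
  using assms
proof (induction d arbitrary: p rule: nat_induct2)
  case 0
  from 0(1) obtain c where "p = [:c:]" by (auto elim: degree_eq_zeroE)
  then show ?case by (intro exI[of _ "[:c:]"]) (simp add: gamma_expansion_def)
next
  case 1
  from 1(2)[of 0] have "coeff p 0 = coeff p 1" by simp
  moreover have "coeff p i = 0" if "i > 1" for i using 1(1) that by (simp add: coeff_eq_0)
  ultimately have "p = [:coeff p 0, coeff p 0:]"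
    by (auto simp: poly_eq_iff coeff_pCons split: nat.split)
  then show ?case
    by (intro exI[of _ "[:coeff p 0:]"]) (simp add: gamma_expansion_small)
next
  case (step d)
  define r where "r = p - smult (coeff p 0) ([:1, 1:] ^ Suc (Suc d))"
  have r: "coeff r i = coeff p i - coeff p 0 * of_nat (Suc (Suc d) choose i)" for i
    unfolding r_def by (simp only: coeff_diff coeff_smult coeff_one_plus_power)
  have "coeff r 0 = 0" by (simp add: r)
  then obtain q where q: "r = pCons 0 q" by (metis coeff_pCons_0 pCons_cases)
  have symm: "coeff r i = coeff r (Suc (Suc d) - i)" if "i \<le> Suc (Suc d)" for i
    using step.prems(2)[of i] that binomial_symmetric[OF that] unfolding r by simp
  have zero: "coeff r i = 0" if "i \<ge> Suc (Suc d)" for i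
  proof (cases "i = Suc (Suc d)")
    case True
    then show ?thesis using symm[of i] \<open>coeff r 0 = 0\<close> by simp
  next
    case False
    then show ?thesis
      using that step.prems(1) unfolding r by (simp add: coeff_eq_0 binomial_eq_0 del: binomial_Suc_Suc)
  qed
  have "degree q \<le> d"
    using zero unfolding q by (intro degree_le) (metis Suc_leI Suc_le_mono coeff_pCons_Suc)
  moreover have "coeff q i = coeff q (d - i)" if "i \<le> d" for i
    using symm[of "Suc i"] that unfolding q by (simp add: Suc_diff_le)
  ultimately obtain \<gamma> where \<gamma>: "degree \<gamma> \<le> d div 2" "q = gamma_expansion d \<gamma>"
    using step.IH by blast
  have "p = gamma_expansion (Suc (Suc d)) (pCons (coeff p 0) \<gamma>)"
    unfolding gamma_expansion_pCons using q r_def \<gamma> by (simp add: algebra_simps)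
  moreover have "degree (pCons (coeff p 0) \<gamma>) \<le> (d + 2) div 2"
    using \<gamma>(1) degree_pCons_le[of "coeff p 0" \<gamma>] by simp
  ultimately show ?case unfolding add_2_eq_Suc' by blast
qed

text \<open>The constant coefficient of the expansion is that of \<open>\<gamma>\<close>, so it
  vanishes and the recursion descends.\<close>

lemma gamma_expansion_eq_0:
  assumes "degree \<gamma> \<le> d div 2" "gamma_expansion d \<gamma> = 0"
  shows "\<gamma> = 0"
  using assms
proof (induction d arbitrary: \<gamma> rule: nat_induct2)
  case 0
  then show ?case by (auto simp: gamma_expansion_def elim: degree_eq_zeroE)
next
  case 1
  then have "[:1, 1:] \<noteq> (0 :: int poly)" "degree \<gamma> = 0" "smult (coeff \<gamma> 0) [:1, 1:] = 0"
    by (simp_all add: gamma_expansion_small del: smult_pCons)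
  then have "coeff \<gamma> 0 = 0" "degree \<gamma> = 0" by (simp_all only: smult_eq_0_iff) auto
  then show ?case by (auto elim: degree_eq_zeroE)
next
  case (step d)
  obtain a \<delta> where \<gamma>: "\<gamma> = pCons a \<delta>" by (rule pCons_cases)
  have eq: "smult a ([:1, 1:] ^ Suc (Suc d)) + pCons 0 (gamma_expansion d \<delta>) = 0"
    using step.prems(2) unfolding \<gamma> by (simp only: gamma_expansion_pCons add_2_eq_Suc')
  have "a = 0"
    using arg_cong[OF eq, of "\<lambda>p. coeff p 0"] by (simp add: coeff_one_plus_power del: power_Suc)
  then have "gamma_expansion d \<delta> = 0" using eq by simp
  moreover have "degree \<delta> \<le> d div 2" using step.prems(1) unfolding \<gamma> by (cases "\<delta> = 0") auto
  ultimately have "\<delta> = 0" using step.IH by blast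
  then show ?case using \<open>a = 0\<close> \<gamma> by simp
qed

text \<open>By linearity, uniqueness amounts to a trivial kernel; this resolves the definite
  description in \<open>gamma_poly\<close>.\<close>

lemma gamma_poly_eqI:
  assumes "degree \<gamma> \<le> d div 2" "h_poly d \<Delta> = gamma_expansion d \<gamma>"
  shows "gamma_poly d \<Delta> = \<gamma>"
  unfolding gamma_poly_def gamma_expansion_def[symmetric]
proof (rule the_equality)
  fix \<delta> assume \<delta>: "degree \<delta> \<le> d div 2 \<and> h_poly d \<Delta> = gamma_expansion d \<delta>"
  have "gamma_expansion d (\<delta> + smult (-1) \<gamma>) = 0"
    unfolding gamma_expansion_add gamma_expansion_smult using assms \<delta> by simp
  moreover have "degree (\<delta> + smult (-1) \<gamma>) \<le> d div 2"
    using assms \<delta> by (intro degree_add_le) simp_all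
  ultimately have "\<delta> + smult (-1) \<gamma> = 0" by (rule gamma_expansion_eq_0[rotated])
  then show "\<delta> = \<gamma>" by simp
qed (use assms in simp)

text \<open>With \<open>c = k - 4\<close> the linear factor belongs to the cycle of length
  \<open>k\<close>; this is the multiplicativity needed for joins with a cycle.\<close>

lemma gamma_expansion_times_linear:
  assumes "degree \<gamma> \<le> d div 2"
  shows "gamma_expansion d \<gamma> * gamma_expansion 2 [:1, c:] =
    gamma_expansion (Suc (Suc d)) (\<gamma> * [:1, c:])"
proof -
  \<comment> \<open>Passing from \<open>d\<close> to \<open>d + 2\<close> multiplies every summand
    by \<open>(1 + t)^2\<close>; the one new index lies above the degree of
    \<open>\<gamma>\<close>.\<close>
  have 1: "gamma_expansion (Suc (Suc d)) \<gamma> = gamma_expansion d \<gamma> * [:1, 1:] ^ 2"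
  proof -
    have "coeff \<gamma> (Suc (d div 2)) = 0" using assms by (simp add: coeff_eq_0)
    then have "gamma_expansion (Suc (Suc d)) \<gamma> =
      (\<Sum>i\<le>d div 2. smult (coeff \<gamma> i) (monom 1 i * [:1, 1:] ^ (d - 2 * i)) * [:1, 1:] ^ 2)"
      unfolding gamma_expansion_def
      by (auto intro!: sum.cong simp: Suc_diff_le power2_eq_square mult_ac simp del: mult_pCons_left mult_pCons_right)
    then show ?thesis by (simp only: gamma_expansion_def sum_distrib_right)
  qed
  have "\<gamma> * [:1, c:] = \<gamma> + pCons 0 (smult c \<gamma>)" by simp
  then have "gamma_expansion (Suc (Suc d)) (\<gamma> * [:1, c:]) =
      gamma_expansion d \<gamma> * [:1, 1:] ^ 2 + pCons 0 (smult c (gamma_expansion d \<gamma>))"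
    by (simp only: gamma_expansion_add gamma_expansion_pCons 1 gamma_expansion_smult) simp
  also have "gamma_expansion 2 [:1, c:] = [:1, 1:] ^ 2 + [:0, c:]"
    using gamma_expansion_pCons[of 0 1 "[:c:]"] by (simp add: gamma_expansion_small numeral_2_eq_2)
  ultimately show ?thesis by (simp add: algebra_simps)
qed

section \<open>Face sums and the Dehn-Sommerville relations\<close>

lemma h_poly_eq_sum:
  assumes "finite \<Delta>" "\<And>f. f \<in> \<Delta> \<Longrightarrow> card f \<le> d"
  shows "h_poly d \<Delta> = (\<Sum>f\<in>\<Delta>. [:-1, 1:] ^ (d - card f))"
proof -
  have "h_poly d \<Delta> = (\<Sum>i\<le>d. \<Sum>f | f \<in> \<Delta> \<and> card f = i. [:-1, 1:] ^ (d - card f))"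
    unfolding h_poly_def face_number_def
    by (intro sum.cong) (simp_all add: of_nat_poly)
  also have "\<dots> = (\<Sum>f\<in>\<Delta>. [:-1, 1:] ^ (d - card f))"
    by (rule sum.group) (use assms in auto)
  finally show ?thesis .
qed

lemma coeff_minus_one_power:
  "i \<le> m \<Longrightarrow> coeff ([:-1, 1:] ^ m) i = (of_nat (m choose i) * (-1) ^ (m - i) :: int)"
  using coeff_linear_poly_power[of i m "-1" 1] by simp

text \<open>\<open>euler\<close> says that the link of \<open>f\<close> has the Euler characteristic
  of a sphere. Inserting it as a factor 1 into the term of each \<open>f\<close>, swapping the sums
  and applying the binomial theorem over \<open>Pow g\<close> rewrites \<open>h(t)\<close> as the
  sum of \<open>t^(card g) * (1 - t)^(d - card g)\<close>, which is
  \<open>t^d * h(1/t)\<close>.\<close>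

lemma dehn_sommerville:
  assumes "finite \<Delta>" "\<And>f. f \<in> \<Delta> \<Longrightarrow> finite f \<and> card f \<le> d"
    and closed: "\<And>f g. f \<in> \<Delta> \<Longrightarrow> g \<subseteq> f \<Longrightarrow> g \<in> \<Delta>"
    and euler: "\<And>f. f \<in> \<Delta> \<Longrightarrow> (\<Sum>g | g \<in> \<Delta> \<and> f \<subseteq> g. (-1) ^ (d - card g)) = (1 :: int)"
  shows "degree (h_poly d \<Delta>) \<le> d"
    and "i \<le> d \<Longrightarrow> coeff (h_poly d \<Delta>) i = coeff (h_poly d \<Delta>) (d - i)"
proof -
  have h: "h_poly d \<Delta> = (\<Sum>f\<in>\<Delta>. [:-1, 1:] ^ (d - card f))"
    using assms by (intro h_poly_eq_sum) auto
  show "degree (h_poly d \<Delta>) \<le> d"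
    unfolding h by (intro degree_sum_le assms) (simp add: degree_linear_power)
  assume i: "i \<le> d"
  have binom: "(\<Sum>f\<in>Pow g. [:-1, 1:] ^ (card g - card f)) = (monom 1 (card g) :: int poly)"
    if g: "finite g" for g :: "'a set"
  proof -
    have "(\<Sum>f\<in>Pow g. [:-1, 1:] ^ (card g - card f)) =
        (\<Sum>k\<le>card g. \<Sum>f | f \<in> Pow g \<and> card f = k. [:-1, 1:] ^ (card g - card f) :: int poly)"
      by (rule sum.group[symmetric]) (use g in \<open>auto intro: card_mono\<close>)
    also have "\<dots> = (\<Sum>k\<le>card g. of_nat (card g choose k) * 1 ^ k * [:-1, 1:] ^ (card g - k))"
      using n_subsets[OF g] by (intro sum.cong) auto
    also have "\<dots> = (1 + [:-1, 1:]) ^ card g" by (rule binomial_ring[symmetric])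
    also have "1 + [:-1, 1:] = (monom 1 1 :: int poly)" by (simp add: one_pCons monom_altdef)
    finally show ?thesis by (simp add: monom_power)
  qed
  have "h_poly d \<Delta> =
      (\<Sum>f\<in>\<Delta>. \<Sum>g | g \<in> \<Delta> \<and> f \<subseteq> g. (-1) ^ (d - card g) * [:-1, 1:] ^ (d - card f))"
    unfolding h
  proof (intro sum.cong refl)
    fix f assume f: "f \<in> \<Delta>"
    have "(\<Sum>g | g \<in> \<Delta> \<and> f \<subseteq> g. (-1) ^ (d - card g)) = (1 :: int poly)"
      using arg_cong[OF euler[OF f], of of_int] by simp
    then show "[:-1, 1:] ^ (d - card f) =
        (\<Sum>g | g \<in> \<Delta> \<and> f \<subseteq> g. (-1) ^ (d - card g) * [:-1, 1:] ^ (d - card f) :: int poly)"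
      by (simp add: sum_distrib_right[symmetric])
  qed
  also have "\<dots> = (\<Sum>g\<in>\<Delta>. \<Sum>f | f \<in> \<Delta> \<and> f \<subseteq> g. (-1) ^ (d - card g) * [:-1, 1:] ^ (d - card f))"
    by (rule sum.swap_restrict) (use assms in auto)
  also have "\<dots> = (\<Sum>g\<in>\<Delta>. monom 1 (card g) * [:1, -1:] ^ (d - card g))"
  proof (intro sum.cong refl)
    fix g assume g: "g \<in> \<Delta>"
    have "{f \<in> \<Delta>. f \<subseteq> g} = Pow g" using closed g by auto
    moreover have "(-1) ^ (d - card g) * [:-1, 1:] ^ (d - card f) =
        [:1, -1:] ^ (d - card g) * ([:-1, 1:] ^ (card g - card f) :: int poly)" if "f \<subseteq> g" for f
    proof -
      have "card f \<le> card g" "card g \<le> d" using that assms(2) g by (auto intro: card_mono)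
      then have "d - card f = (d - card g) + (card g - card f)" by simp
      then show ?thesis
        by (simp add: power_add flip: power_mult_distrib mult.assoc)
    qed
    ultimately show "(\<Sum>f | f \<in> \<Delta> \<and> f \<subseteq> g. (-1) ^ (d - card g) * [:-1, 1:] ^ (d - card f)) =
        (monom 1 (card g) * [:1, -1:] ^ (d - card g) :: int poly)"
      using binom[of g] assms(2)[OF g] by (simp add: mult.commute flip: sum_distrib_left)
  qed
  finally have h': "h_poly d \<Delta> = (\<Sum>g\<in>\<Delta>. monom 1 (card g) * [:1, -1:] ^ (d - card g))" .
  \<comment> \<open>Coefficientwise form of the reversal
    \<open>t^d * (1/t - 1)^(d - card g)\<close>, which avoids negative powers.\<close>
  have "coeff (monom 1 (card g) * [:1, -1:] ^ (d - card g)) i =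
      coeff ([:-1, 1:] ^ (d - card g) :: int poly) (d - i)" if g: "g \<in> \<Delta>" for g
  proof (cases "card g \<le> i")
    case True
    have g: "card g \<le> d" using assms(2) g by blast
    have "coeff (monom 1 (card g) * [:1, -1:] ^ (d - card g)) i =
        coeff ([:1, -1:] ^ (d - card g) :: int poly) (i - card g)"
      using True by (simp add: coeff_monom_mult)
    also have "\<dots> = of_nat (d - card g choose (i - card g)) * (-1) ^ (i - card g)"
      using coeff_linear_poly_power[of "i - card g" "d - card g" "1 :: int" "-1"] i by simp
    also have "d - card g choose (i - card g) = d - card g choose (d - i)"
      using binomial_symmetric[of "i - card g" "d - card g"] i True g by simp
    also have "of_nat \<dots> * (-1) ^ (i - card g) = coeff ([:-1, 1:] ^ (d - card g) :: int poly) (d - i)"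
      using coeff_minus_one_power[of "d - i" "d - card g"] i True g by simp
    finally show ?thesis .
  next
    case False
    then have "degree ([:-1, 1:] ^ (d - card g) :: int poly) < d - i"
      using i assms(2)[OF g] unfolding degree_linear_power by linarith
    then have "coeff ([:-1, 1:] ^ (d - card g) :: int poly) (d - i) = 0" by (rule coeff_eq_0)
    then show ?thesis using False by (simp add: coeff_monom_mult)
  qed
  then have "coeff (h_poly d \<Delta>) i = (\<Sum>g\<in>\<Delta>. coeff ([:-1, 1:] ^ (d - card g)) (d - i))"
    unfolding h' coeff_sum by (intro sum.cong) auto
  then show "coeff (h_poly d \<Delta>) i = coeff (h_poly d \<Delta>) (d - i)"
    unfolding h coeff_sum by simp
qed

text \<open>The expansion shows the two lowest coefficients, \<open>coeff \<gamma> 0\<close> and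
  \<open>d * coeff \<gamma> 0 + coeff \<gamma> 1\<close>, while the face numbers show the two
  highest, 1 and \<open>f_1 - d\<close>. Symmetry identifies them.\<close>

lemma coeff_gamma_poly_1:
  assumes d: "d \<ge> 2" and "{} \<in> \<Delta>" "finite \<Delta>" "\<And>f. f \<in> \<Delta> \<Longrightarrow> finite f"
    and "degree (h_poly d \<Delta>) \<le> d"
    and sym: "\<And>i. i \<le> d \<Longrightarrow> coeff (h_poly d \<Delta>) i = coeff (h_poly d \<Delta>) (d - i)"
  shows "coeff (gamma_poly d \<Delta>) 1 = int (face_number \<Delta> 1) - 2 * int d"
proof -
  obtain e where e: "d = Suc (Suc e)" using d by (metis add_2_eq_Suc le_Suc_ex)
  obtain \<gamma> where \<gamma>: "degree \<gamma> \<le> d div 2" "h_poly d \<Delta> = gamma_expansion d \<gamma>"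
    using ex_gamma_expansion assms(5) sym by blast
  obtain a \<delta> where a: "\<gamma> = pCons a \<delta>" by (rule pCons_cases)
  have f0: "face_number \<Delta> 0 = 1"
  proof -
    have "{f \<in> \<Delta>. card f = 0} = {{}}" using assms by auto
    then show ?thesis by (simp add: face_number_def)
  qed
  have "poly (gamma_expansion e \<delta>) 0 = (\<Sum>i\<le>e div 2. if i = 0 then coeff \<delta> i else 0)"
    unfolding gamma_expansion_def poly_sum by (intro sum.cong) (simp_all add: poly_monom)
  then have c0: "coeff (gamma_expansion e \<delta>) 0 = coeff \<delta> 0"
    by (simp add: poly_0_coeff_0 sum.delta)
  have "h_poly d \<Delta> = smult a ([:1, 1:] ^ d) + pCons 0 (gamma_expansion e \<delta>)"
    using \<gamma>(2) gamma_expansion_pCons[of e a \<delta>] by (simp only: a e)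
  then have lo: "coeff (h_poly d \<Delta>) 0 = a" "coeff (h_poly d \<Delta>) 1 = a * int d + coeff \<delta> 0"
    using c0 by (simp_all add: coeff_one_plus_power)
  have deg: "coeff ([:-1, 1:] ^ k :: int poly) j = 0" if "k < j" for k j
    using that by (intro coeff_eq_0) (simp add: degree_linear_power)
  have h: "h_poly d \<Delta> = [:-1, 1:] ^ d + smult (int (face_number \<Delta> 1)) ([:-1, 1:] ^ (d - 1)) +
      (\<Sum>i\<le>e. smult (int (face_number \<Delta> (Suc (Suc i)))) ([:-1, 1:] ^ (e - i)))"
    unfolding h_poly_def e by (simp add: sum.atMost_Suc_shift f0 del: power_Suc sum.atMost_Suc)
  have "coeff (h_poly d \<Delta>) d = 1"
    "coeff (h_poly d \<Delta>) (d - 1) = int (face_number \<Delta> 1) - int d"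
    unfolding h by (simp_all add: coeff_sum deg coeff_minus_one_power e del: power_Suc)
  then have "a = 1" "a * int d + coeff \<delta> 0 = int (face_number \<Delta> 1) - int d"
    using sym[of 0] sym[of 1] d lo by simp_all
  then show ?thesis
    using gamma_poly_eqI[OF \<gamma>] a by simp
qed

section \<open>h-polynomials of isomorphic complexes, joins and cycles\<close>

lemma h_poly_isomorphic:
  assumes "isomorphic_complexes \<Delta> \<Delta>'"
  shows "h_poly d \<Delta> = h_poly d \<Delta>'"
proof -
  obtain \<phi> where \<phi>: "inj_on \<phi> (vertices \<Delta>)" "(\<lambda>f. \<phi> ` f) ` \<Delta> = \<Delta>'"
    using assms by (auto simp: isomorphic_complexes_def bij_betw_def)
  have inj: "inj_on \<phi> f" if "f \<in> \<Delta>" for f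
    using \<phi>(1) by (rule inj_on_subset) (use that in \<open>auto simp: vertices_def\<close>)
  have "face_number \<Delta> i = face_number \<Delta>' i" for i
    unfolding face_number_def
  proof (rule bij_betw_same_card[of "image \<phi>"])
    have "inj_on (image \<phi>) (Pow (vertices \<Delta>))" using \<phi>(1) by (rule inj_on_image_Pow)
    then have "inj_on (image \<phi>) {f \<in> \<Delta>. card f = i}"
      by (rule inj_on_subset) (auto simp: vertices_def)
    moreover have "image \<phi> ` {f \<in> \<Delta>. card f = i} = {f \<in> \<Delta>'. card f = i}"
      using \<phi>(2) card_image[OF inj] by (auto simp: image_iff)
    ultimately show "bij_betw (image \<phi>) {f \<in> \<Delta>. card f = i} {f \<in> \<Delta>'. card f = i}"
      by (simp add: bij_betw_def)
  qed
  then show ?thesis by (simp add: h_poly_def)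
qed

text \<open>Faces of the join are pairs of faces and cardinalities add, so the face sum
  factors.\<close>

lemma h_poly_join:
  assumes A: "finite A" "\<And>f. f \<in> A \<Longrightarrow> finite f \<and> card f \<le> a"
    and B: "finite B" "\<And>g. g \<in> B \<Longrightarrow> finite g \<and> card g \<le> b"
  shows "h_poly (a + b) (join A B) = h_poly a A * h_poly b B"
proof -
  have join: "join A B = (\<lambda>(f, g). f <+> g) ` (A \<times> B)"
    by (auto simp: join_def)
  have "Inl -` (f <+> g) = f" "Inr -` (f <+> g) = g" for f :: "'a set" and g :: "'b set"
    by auto
  then have "f = f' \<and> g = g'" if "f <+> g = f' <+> g'" for f f' :: "'a set" and g g' :: "'b set"
    using that by metis
  then have inj: "inj_on (\<lambda>(f, g). f <+> g) (A \<times> B)"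
    by (intro inj_onI) (simp add: case_prod_unfold prod_eq_iff)
  have card: "card (f <+> g) = card f + card g" if "f \<in> A" "g \<in> B" for f g
    using A B that by (intro card_Plus) auto
  have "h_poly (a + b) (join A B) = (\<Sum>f\<in>join A B. [:-1, 1:] ^ (a + b - card f))"
    unfolding join using A B by (intro h_poly_eq_sum) (auto simp: card intro!: add_mono)
  also have "\<dots> = (\<Sum>(f, g)\<in>A \<times> B. [:-1, 1:] ^ (a + b - card (f <+> g)))"
    unfolding join by (subst sum.reindex[OF inj]) (simp add: case_prod_unfold)
  also have "\<dots> = (\<Sum>(f, g)\<in>A \<times> B. [:-1, 1:] ^ (a - card f) * [:-1, 1:] ^ (b - card g))"
  proof (intro sum.cong refl, clarify)
    fix f g assume fg: "f \<in> A" "g \<in> B"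
    then have "a + b - card (f <+> g) = (a - card f) + (b - card g)"
      using A(2)[of f] B(2)[of g] card by auto
    then show "[:-1, 1:] ^ (a + b - card (f <+> g)) =
        [:-1, 1:] ^ (a - card f) * ([:-1, 1:] ^ (b - card g) :: int poly)"
      by (simp add: power_add)
  qed
  also have "\<dots> = h_poly a A * h_poly b B"
    using A B by (simp add: h_poly_eq_sum sum_product sum.cartesian_product)
  finally show ?thesis .
qed

text \<open>\<open>k \<ge> 3\<close> excludes the digon, whose two edges coincide as sets.\<close>

lemma card_cycle_complex_edges:
  assumes "k \<ge> 3"
  shows "card {{i, Suc i mod k} | i. i < k} = k"
proof -
  have mod: "Suc i mod k = (if Suc i = k then 0 else Suc i)" if "i < k" for i
    using that by auto
  have "inj_on (\<lambda>i. {i, Suc i mod k}) {..<k}"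
  proof (rule inj_onI)
    fix i j assume ij: "i \<in> {..<k}" "j \<in> {..<k}" "{i, Suc i mod k} = {j, Suc j mod k}"
    show "i = j"
    proof (rule ccontr)
      assume "i \<noteq> j"
      then have "i = Suc j mod k" "j = Suc i mod k" using ij(3) by (auto simp: doubleton_eq_iff)
      moreover have "i < k" "j < k" using ij by auto
      ultimately have "Suc j = k \<and> i = 0 \<or> i = Suc j" "Suc i = k \<and> j = 0 \<or> j = Suc i"
        by (metis mod)+
      then show False using assms by linarith
    qed
  qed
  moreover have "{{i, Suc i mod k} | i. i < k} = (\<lambda>i. {i, Suc i mod k}) ` {..<k}" by auto
  ultimately show ?thesis by (simp add: card_image)
qed

lemma cycle_complex_faces:
  assumes "k \<ge> 3"
  shows "finite (cycle_complex k)" "f \<in> cycle_complex k \<Longrightarrow> finite f \<and> card f \<le> 2"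
    "vertices (cycle_complex k) = {..<k}"
proof -
  have "{{i} | i. i < k} = (\<lambda>i. {i}) ` {..<k}"
    "{{i, Suc i mod k} | i. i < k} = (\<lambda>i. {i, Suc i mod k}) ` {..<k}" by auto
  then show "finite (cycle_complex k)" unfolding cycle_complex_def by simp
  show "finite f \<and> card f \<le> 2" if "f \<in> cycle_complex k"
    using that by (auto simp: cycle_complex_def card_insert_if)
  show "vertices (cycle_complex k) = {..<k}"
    using assms by (auto simp: cycle_complex_def vertices_def)
qed

text \<open>Both sides are \<open>(z - 1)^2 + k(z - 1) + k = (1 + z)^2 + (k - 4)z\<close>.\<close>

lemma h_poly_cycle_complex:
  assumes "k \<ge> 3"
  shows "h_poly 2 (cycle_complex k) = gamma_expansion 2 [:1, int k - 4:]"
proof -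
  have ne: "i \<noteq> Suc i mod k" if "i < k" for i
    using that assms by (cases "Suc i = k") auto
  have "{f \<in> cycle_complex k. card f = 0} = {{}}"
    "{f \<in> cycle_complex k. card f = 1} = (\<lambda>i. {i}) ` {..<k}"
    "{f \<in> cycle_complex k. card f = 2} = {{i, Suc i mod k} | i. i < k}"
    using ne by (auto simp: cycle_complex_def)
  then have "face_number (cycle_complex k) 0 = 1" "face_number (cycle_complex k) 1 = k"
    "face_number (cycle_complex k) 2 = k"
    using card_cycle_complex_edges[OF assms] by (simp_all add: face_number_def card_image)
  then show ?thesis
    by (simp add: h_poly_def gamma_expansion_def numeral_2_eq_2 power2_eq_square monom_altdef)
qed

section \<open>Euler characteristic and connectedness from homology\<close>

text \<open>Rank-nullity on a finite-dimensional subspace, since chains live in the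
  infinite-dimensional space of all functions on lists. A basis of the kernel is extended to one of
  \<open>V\<close>, and \<open>f\<close> is injective on the span of the added vectors.\<close>

lemma (in vector_space) dim_kernel_image:
  assumes f: "Vector_Spaces.linear scale scale f" and V: "subspace V" "finite W" "V \<subseteq> span W"
  shows "dim V = dim {x \<in> V. f x = 0} + dim (f ` V)"
proof -
  interpret f: Vector_Spaces.linear scale scale f by (rule f)
  interpret vector_space_pair scale scale ..
  obtain B where B: "B \<subseteq> {x \<in> V. f x = 0}" "independent B" "{x \<in> V. f x = 0} \<subseteq> span B"
    by (rule maximal_independent_subset)
  obtain B' where B': "B \<subseteq> B'" "B' \<subseteq> V" "independent B'" "V \<subseteq> span B'"
    by (rule maximal_independent_subset_extend[of B V]) (use B in auto)
  have fin: "finite B'"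
    using independent_span_bound[OF V(2) B'(3)] B'(2) V(3) by auto
  define C where "C = B' - B"
  have CV: "span C \<subseteq> V" using B' V span_minimal[of C V] by (auto simp: C_def)
  \<comment> \<open>Such a vector is represented both over \<open>B\<close> and over
    \<open>C\<close>, which are disjoint, so all its coefficients vanish.\<close>
  have "x = 0" if x: "x \<in> span C" "f x = 0" for x
  proof -
    have xB: "x \<in> span B" using x CV B(3) by auto
    have xB': "x \<in> span B'" using x(1) span_mono[of C B'] by (auto simp: C_def)
    have "representation B' x = representation B x"
      by (rule representation_extend[OF B'(3) xB B'(1)])
    moreover have "representation B' x = representation C x"
      by (rule representation_extend[OF B'(3) x(1)]) (simp add: C_def)
    ultimately have "representation B' x b = 0" for b
      using representation_ne_zero[of B x b] representation_ne_zero[of C x b] by (auto simp: C_def)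
    then show "x = 0" using sum_nonzero_representation_eq[OF B'(3) xB'] by simp
  qed
  then have inj: "inj_on f (span C)"
    using linear_inj_on_iff_eq_0[OF f subspace_span] by blast
  have ind: "independent C" using B'(3) independent_mono by (auto simp: C_def)
  have "dim (f ` V) = card (f ` C)"
  proof (rule dim_unique[OF _ _ _ refl])
    show "f ` C \<subseteq> f ` V" using B' by (auto simp: C_def)
    show "independent (f ` C)"
      by (rule linear_independent_injective_image[OF f ind inj])
    have "f ` V \<subseteq> f ` span B'" using B' by auto
    also have "\<dots> = span (f ` B')" by (simp add: linear_span_image[OF f])
    also have "\<dots> \<subseteq> span (insert 0 (f ` C))"
      by (rule span_mono) (use B in \<open>auto simp: C_def\<close>)
    finally show "f ` V \<subseteq> span (f ` C)" by simp
  qed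
  also have "\<dots> = card C"
    using inj by (intro card_image) (meson inj_on_subset span_superset)
  also have "card C = card B' - card B"
    using fin B' by (simp add: C_def card_Diff_subset finite_subset)
  moreover have "dim V = card B'" "dim {x \<in> V. f x = 0} = card B"
    using dim_unique[of B' V] dim_unique[of B "{x \<in> V. f x = 0}"] B B' by auto
  ultimately show ?thesis
    using card_mono[OF fin B'(1)] by simp
qed

section \<open>Chain spaces and boundary maps\<close>

interpretation fun_space: vector_space "\<lambda>(a :: 'k::field) (c :: 'b \<Rightarrow> 'k) x. a * c x"
  by unfold_locales (auto simp: fun_eq_iff algebra_simps)

lemma simplicial_chainsD:
  assumes "c \<in> simplicial_chains i \<Delta>" "c xs \<noteq> 0"
  shows "distinct xs" "set xs \<in> \<Delta>" "int (length xs) = i + 1"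
  using assms unfolding simplicial_chains_def by blast+

lemma simplicial_chains_swap:
  "c \<in> simplicial_chains i \<Delta> \<Longrightarrow> c (xs @ a # b # ys) = - c (xs @ b # a # ys)"
  unfolding simplicial_chains_def by blast

lemma simplicial_chainsI:
  assumes "\<And>xs. c xs \<noteq> 0 \<Longrightarrow> distinct xs \<and> set xs \<in> \<Delta> \<and> int (length xs) = i + 1"
    and "\<And>xs a b ys. c (xs @ a # b # ys) = - c (xs @ b # a # ys)"
  shows "c \<in> simplicial_chains i \<Delta>"
  using assms unfolding simplicial_chains_def by blast

lemma simplicial_chains_subspace:
  "fun_space.subspace (simplicial_chains i \<Delta> :: ('a list \<Rightarrow> 'k::field) set)"
proof (rule fun_space.subspaceI)
  fix c d :: "'a list \<Rightarrow> 'k"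
  assume cd: "c \<in> simplicial_chains i \<Delta>" "d \<in> simplicial_chains i \<Delta>"
  show "c + d \<in> simplicial_chains i \<Delta>"
  proof (rule simplicial_chainsI)
    fix xs assume "(c + d) xs \<noteq> 0"
    then have "c xs \<noteq> 0 \<or> d xs \<noteq> 0" by auto
    then show "distinct xs \<and> set xs \<in> \<Delta> \<and> int (length xs) = i + 1"
      using simplicial_chainsD cd by metis
  next
    show "(c + d) (xs @ x # y # ys) = - (c + d) (xs @ y # x # ys)" for xs x y ys
      using simplicial_chains_swap[OF cd(1), of xs x y ys] simplicial_chains_swap[OF cd(2), of xs x y ys]
      by simp
  qed
next
  fix a and c :: "'a list \<Rightarrow> 'k"
  assume c: "c \<in> simplicial_chains i \<Delta>"
  show "(\<lambda>x. a * c x) \<in> simplicial_chains i \<Delta>"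
  proof (rule simplicial_chainsI)
    show "a * c (xs @ x # y # ys) = - (a * c (xs @ y # x # ys))" for xs x y ys
      using simplicial_chains_swap[OF c, of xs x y ys] by simp
  qed (use simplicial_chainsD[OF c] in auto)
qed (simp add: simplicial_chains_def)

lemma boundary_map_linear:
  "Vector_Spaces.linear (\<lambda>a c x. a * c x) (\<lambda>a c x. a * c x)
    (boundary_map \<Delta> :: ('a list \<Rightarrow> 'k::field) \<Rightarrow> _)"
proof -
  have "boundary_map \<Delta> (c + c') = boundary_map \<Delta> c + boundary_map \<Delta> c'"
    "boundary_map \<Delta> (\<lambda>x. a * c x) = (\<lambda>x. a * boundary_map \<Delta> c x)" for a and c c' :: "'a list \<Rightarrow> 'k"
    by (simp_all add: boundary_map_def fun_eq_iff sum.distrib sum_distrib_left)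
  then show ?thesis
    unfolding Vector_Spaces.linear_iff using fun_space.vector_space_axioms by blast
qed

text \<open>The diagonal is required to vanish because antisymmetry alone does not force it in
  characteristic 2.\<close>

lemma sum_antisymmetric_eq_0:
  fixes e :: "'a \<Rightarrow> 'a \<Rightarrow> 'k::field"
  assumes "\<And>x y. e x y = - e y x" "\<And>x. e x x = 0"
  shows "(\<Sum>x\<in>A. \<Sum>y\<in>A. e x y) = 0"
proof (induction A rule: infinite_finite_induct)
  case (insert x A)
  have "(\<Sum>z\<in>A. e z x) = - (\<Sum>y\<in>A. e x y)"
    using assms(1) by (metis (no_types, lifting) sum.cong sum_negf)
  then show ?case using insert assms(2) by (simp add: sum.distrib)
qed auto

text \<open>Exchanging the first two entries changes the sign and repeated entries contribute zero,
  so the double sum cancels.\<close>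

lemma boundary_boundary:
  assumes "c \<in> simplicial_chains i \<Delta>"
  shows "boundary_map \<Delta> (boundary_map \<Delta> c) = 0"
proof
  fix ys
  have "(\<Sum>x\<in>vertices \<Delta>. \<Sum>y\<in>vertices \<Delta>. c (y # x # ys)) = 0"
  proof (rule sum_antisymmetric_eq_0)
    show "c (y # x # ys) = - c (x # y # ys)" for x y
      using simplicial_chains_swap[OF assms, of "[]" y x ys] by simp
    show "c (x # x # ys) = 0" for x
      using simplicial_chainsD(1)[OF assms] by force
  qed
  then show "boundary_map \<Delta> (boundary_map \<Delta> c) ys = 0 ys"
    by (simp add: boundary_map_def)
qed

lemma boundary_map_chains:
  assumes \<Delta>: "simplicial_complex \<Delta>" and c: "c \<in> simplicial_chains (i + 1) \<Delta>"
  shows "boundary_map \<Delta> c \<in> simplicial_chains i \<Delta>"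
proof -
  have "distinct ys \<and> set ys \<in> \<Delta> \<and> int (length ys) = i + 1" if "boundary_map \<Delta> c ys \<noteq> 0" for ys
  proof -
    obtain v where "c (v # ys) \<noteq> 0"
      using \<open>boundary_map \<Delta> c ys \<noteq> 0\<close> unfolding boundary_map_def by (meson sum.not_neutral_contains_not_neutral)
    from simplicial_chainsD[OF c this] show ?thesis
      using \<Delta> by (auto simp: simplicial_complex_def)
  qed
  moreover have "boundary_map \<Delta> c (xs @ a # b # ys) = - boundary_map \<Delta> c (xs @ b # a # ys)" for xs a b ys
  proof -
    have "c (v # xs @ a # b # ys) = - c (v # xs @ b # a # ys)" for v
      using simplicial_chains_swap[OF c, of "v # xs" a b ys] by simp
    then show ?thesis by (simp only: boundary_map_def sum_negf)
  qed
  ultimately show ?thesis by (intro simplicial_chainsI) blast+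
qed

text \<open>One ordering of a face determines a chain on all orderings up to sign; tracking only
  vanishing avoids the sign of the permutation.\<close>

lemma chain_eq_0_permute:
  assumes c: "c \<in> simplicial_chains i \<Delta>"
  shows "c (ps @ xs) = 0 \<Longrightarrow> mset xs = mset ys \<Longrightarrow> c (ps @ ys) = 0"
proof (induction xs arbitrary: ps ys)
  case (Cons x xs)
  then have "x \<in> set ys" by (metis list.set_intros(1) set_mset_mset)
  then obtain us vs where ys: "ys = us @ x # vs" by (meson split_list)
  have move: "c (ps @ us @ x # vs) = 0 \<longleftrightarrow> c (ps @ x # us @ vs) = 0" for ps us vs
  proof (induction us arbitrary: ps)
    case (Cons u us)
    have "c (ps @ u # us @ x # vs) = 0 \<longleftrightarrow> c (ps @ u # x # us @ vs) = 0"
      using Cons[of "ps @ [u]"] by simp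
    then show ?case using simplicial_chains_swap[OF c, of ps u x "us @ vs"] by simp
  qed simp
  have "mset xs = mset (us @ vs)" using Cons.prems(2) ys by simp
  then have "c ((ps @ [x]) @ us @ vs) = 0" using Cons.IH[of "ps @ [x]"] Cons.prems(1) by simp
  then show ?case using move ys by simp
qed simp

section \<open>A basis of oriented simplices\<close>

fun inversions :: "('a \<Rightarrow> nat) \<Rightarrow> 'a list \<Rightarrow> nat" where
  "inversions r [] = 0"
| "inversions r (x # xs) = length (filter (\<lambda>y. r y < r x) xs) + inversions r xs"

lemma inversions_swap:
  assumes "r a \<noteq> r b"
  shows "(-1 :: 'k::field) ^ inversions r (xs @ a # b # ys) = - ((-1) ^ inversions r (xs @ b # a # ys))"
proof (induction xs)
  case Nil
  then show ?case using assms by (cases "r a < r b") (auto simp: power_add)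
qed (simp add: power_add)

text \<open>The sign of \<open>xs\<close> relative to the vertex order induced by \<open>r\<close>
  is taken as the parity of its inversions, so that adjacent swaps are easy to follow.\<close>

definition oriented_simplex :: "('a \<Rightarrow> nat) \<Rightarrow> 'a set \<Rightarrow> 'a list \<Rightarrow> 'k::field" where
  "oriented_simplex r F xs = (if distinct xs \<and> set xs = F then (-1) ^ inversions r xs else 0)"

lemma oriented_simplex_chain:
  assumes "F \<in> \<Delta>" "inj_on r F" "int (card F) = i + 1"
  shows "(oriented_simplex r F :: 'a list \<Rightarrow> 'k::field) \<in> simplicial_chains i \<Delta>"
proof -
  have "oriented_simplex r F (xs @ a # b # ys) = (- oriented_simplex r F (xs @ b # a # ys) :: 'k)" for xs a b ys
  proof (cases "distinct (xs @ a # b # ys) \<and> set (xs @ a # b # ys) = F")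
    case True
    then have "r a \<noteq> r b" using assms(2) by (auto dest: inj_onD)
    then show ?thesis using True inversions_swap[of r a b xs ys] by (auto simp: oriented_simplex_def)
  next
    case False
    then have "\<not> (distinct (xs @ b # a # ys) \<and> set (xs @ b # a # ys) = F)" by auto
    then show ?thesis using False unfolding oriented_simplex_def by (simp only: if_False if_not_P minus_zero)
  qed
  moreover have "distinct xs \<and> set xs \<in> \<Delta> \<and> int (length xs) = i + 1"
    if "oriented_simplex r F xs \<noteq> (0 :: 'k)" for xs
    using that assms(1,3) by (auto simp: oriented_simplex_def distinct_card split: if_splits)
  ultimately show ?thesis by (intro simplicial_chainsI) blast+
qed

lemma sum_fun_apply: "(\<Sum>x\<in>A. g x) y = (\<Sum>x\<in>A. g x y)"
  by (induction A rule: infinite_finite_induct) auto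

text \<open>The oriented simplices of the faces with \<open>k\<close> elements form a basis, since
  evaluating them at one chosen ordering of each face gives a diagonal matrix of signs. The finite
  spanning set is exported because \<open>dim_kernel_image\<close> asks for one.\<close>

lemma dim_simplicial_chains:
  fixes \<Delta> :: "'a set set"
  assumes \<Delta>: "simplicial_complex \<Delta>"
  obtains B :: "('a list \<Rightarrow> 'k::field) set" where "finite B"
    "simplicial_chains (int k - 1) \<Delta> \<subseteq> fun_space.span B"
    "fun_space.dim (simplicial_chains (int k - 1) \<Delta> :: ('a list \<Rightarrow> 'k) set) = face_number \<Delta> k"
proof -
  have finV: "finite (vertices \<Delta>)" using \<Delta> by (simp add: simplicial_complex_def)
  obtain r :: "'a \<Rightarrow> nat" where r: "inj_on r (vertices \<Delta>)"
    using finite_imp_inj_to_nat_seg[OF finV] by blast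
  define \<F> where "\<F> = {F \<in> \<Delta>. card F = k}"
  have \<F>: "\<F> \<subseteq> Pow (vertices \<Delta>)" by (auto simp: \<F>_def vertices_def)
  then have fin: "finite \<F>" using finV by (meson finite_Pow_iff finite_subset)
  have "\<forall>F. \<exists>xs. F \<in> \<F> \<longrightarrow> distinct xs \<and> set xs = F"
    using \<F> finV by (meson PowD finite_distinct_list finite_subset subsetD)
  then obtain ord where ord: "\<And>F. F \<in> \<F> \<Longrightarrow> distinct (ord F) \<and> set (ord F) = F"
    by metis
  define \<chi> :: "'a set \<Rightarrow> 'a list \<Rightarrow> 'k" where "\<chi> = oriented_simplex r"
  have eval: "\<chi> F (ord G) = (if F = G then (-1) ^ inversions r (ord G) else 0)" if "F \<in> \<F>" "G \<in> \<F>" for F G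
    using ord[OF that(2)] by (auto simp: \<chi>_def oriented_simplex_def)
  have \<chi>_chain: "\<chi> F \<in> simplicial_chains (int k - 1) \<Delta>" if "F \<in> \<F>" for F
    unfolding \<chi>_def using that \<F> r
    by (intro oriented_simplex_chain) (auto simp: \<F>_def vertices_def intro: inj_on_subset)
  have inj: "inj_on \<chi> \<F>"
  proof (rule inj_onI)
    fix F G assume *: "F \<in> \<F>" "G \<in> \<F>" "\<chi> F = \<chi> G"
    then have "\<chi> F (ord G) = \<chi> G (ord G)" by simp
    then show "F = G" using eval[of F G] eval[of G G] * by (auto split: if_splits)
  qed
  have ind: "fun_space.independent (\<chi> ` \<F>)"
  proof (rule fun_space.independent_if_scalars_zero)
    fix u x assume u: "(\<Sum>x\<in>\<chi> ` \<F>. (\<lambda>y. u x * x y)) = 0" and "x \<in> \<chi> ` \<F>"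
    then obtain G where G: "G \<in> \<F>" "x = \<chi> G" by auto
    have "0 = (\<Sum>x\<in>\<chi> ` \<F>. (\<lambda>y. u x * x y)) (ord G)" using u by simp
    also have "\<dots> = (\<Sum>F\<in>\<F>. u (\<chi> F) * \<chi> F (ord G))"
      by (simp add: sum_fun_apply sum.reindex[OF inj])
    also have "\<dots> = (\<Sum>F\<in>\<F>. if F = G then u (\<chi> G) * (-1) ^ inversions r (ord G) else 0)"
      using eval G by (intro sum.cong) auto
    also have "\<dots> = u (\<chi> G) * (-1) ^ inversions r (ord G)" using fin G by simp
    finally show "u x = 0" using G by simp
  qed (use fin in simp)
  have span: "simplicial_chains (int k - 1) \<Delta> \<subseteq> fun_space.span (\<chi> ` \<F>)"
  proof
    fix c :: "'a list \<Rightarrow> 'k" assume c: "c \<in> simplicial_chains (int k - 1) \<Delta>"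
    \<comment> \<open>Signs are their own inverses, so this combination agrees with \<open>c\<close>
      at every chosen ordering.\<close>
    define e where "e = (\<Sum>F\<in>\<F>. (\<lambda>y. (c (ord F) * (-1) ^ inversions r (ord F)) * \<chi> F y))"
    have e_span: "e \<in> fun_space.span (\<chi> ` \<F>)"
      unfolding e_def by (intro fun_space.span_sum fun_space.span_scale fun_space.span_base) auto
    have e: "e \<in> simplicial_chains (int k - 1) \<Delta>"
      unfolding e_def using \<chi>_chain simplicial_chains_subspace
      by (intro fun_space.subspace_sum fun_space.subspace_scale) auto
    have d: "c - e \<in> simplicial_chains (int k - 1) \<Delta>"
      using c e simplicial_chains_subspace by (rule fun_space.subspace_diff[rotated])
    have zero: "(c - e) (ord G) = 0" if G: "G \<in> \<F>" for G
    proof -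
      have "e (ord G) = (\<Sum>F\<in>\<F>. if F = G then c (ord G) * ((-1) ^ inversions r (ord G) * (-1) ^ inversions r (ord G)) else 0)"
        unfolding e_def sum_fun_apply using eval G by (intro sum.cong) auto
      also have "\<dots> = c (ord G)" using fin G by (simp flip: power_mult_distrib)
      finally show ?thesis by simp
    qed
    have "(c - e) xs = 0" for xs
    proof (rule ccontr)
      assume nz: "(c - e) xs \<noteq> 0"
      then have "set xs \<in> \<F>" "distinct xs"
        using simplicial_chainsD[OF d nz] by (auto simp: \<F>_def distinct_card)
      moreover from this have "mset (ord (set xs)) = mset xs"
        using ord set_eq_iff_mset_eq_distinct by blast
      ultimately show False
        using chain_eq_0_permute[OF d, of "[]" "ord (set xs)" xs] zero nz by simp
    qed
    then have "c = e" by (auto simp: fun_eq_iff)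
    then show "c \<in> fun_space.span (\<chi> ` \<F>)" using e_span by simp
  qed
  show thesis
  proof
    show "finite (\<chi> ` \<F>)" using fin by simp
    have "fun_space.dim (simplicial_chains (int k - 1) \<Delta> :: ('a list \<Rightarrow> 'k) set) = card (\<chi> ` \<F>)"
      using \<chi>_chain span ind by (intro fun_space.dim_unique[of "\<chi> ` \<F>"]) auto
    then show "fun_space.dim (simplicial_chains (int k - 1) \<Delta> :: ('a list \<Rightarrow> 'k) set) = face_number \<Delta> k"
      using card_image[OF inj] by (simp add: \<F>_def face_number_def)
  qed (rule span)
qed

section \<open>From homology to Euler characteristics and connectedness\<close>

lemma boundary_map_0: "boundary_map \<Delta> (\<lambda>_. 0) = (\<lambda>_. 0)"
  by (simp add: boundary_map_def)

lemma zero_chain: "(\<lambda>_. 0) \<in> simplicial_chains i \<Delta>"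
  by (simp add: simplicial_chains_def)

lemma homology_zero_cycles:
  assumes "reduced_homology_is_zero TYPE('k::field) i \<Delta>"
    and x: "(x :: 'a list \<Rightarrow> 'k) \<in> simplicial_cycles i \<Delta>"
  shows "x \<in> simplicial_boundaries i \<Delta>"
proof -
  have "homologous i \<Delta> `` {x} \<in> reduced_homology i \<Delta>"
    unfolding reduced_homology_def using x by (rule quotientI)
  then have "homologous i \<Delta> `` {x} = homologous i \<Delta> `` {\<lambda>_. 0}"
    using assms(1) unfolding reduced_homology_is_zero_def homology_class_def by simp
  moreover have "(\<lambda>_. 0 :: 'k) \<in> simplicial_boundaries i \<Delta>"
    unfolding simplicial_boundaries_def
    by (subst boundary_map_0[of \<Delta>, symmetric]) (intro imageI zero_chain)
  then have "(x, x) \<in> homologous i \<Delta>" using x by (simp add: homologous_def)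
  ultimately have "(\<lambda>_. 0, x) \<in> homologous i \<Delta>" by blast
  then obtain e where e: "e \<in> simplicial_chains (i + 1) \<Delta>" "(\<lambda>xs. 0 - x xs) = boundary_map \<Delta> e"
    unfolding homologous_def simplicial_boundaries_def by auto
  have "- e \<in> simplicial_chains (i + 1) \<Delta>"
    using e(1) simplicial_chains_subspace by (rule fun_space.subspace_neg[rotated])
  moreover have "boundary_map \<Delta> (- e) = x"
  proof
    fix xs
    show "boundary_map \<Delta> (- e) xs = x xs"
      using fun_cong[OF e(2), of xs] by (simp add: boundary_map_def sum_negf minus_equation_iff)
  qed
  ultimately show ?thesis unfolding simplicial_boundaries_def by blast
qed

text \<open>Without nonzero chains one degree higher the only boundary is zero and homology classes
  are singletons, so the isomorphism onto the field lives on the cycles; the preimage of 1 spans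
  them.\<close>

lemma dim_cycles_of_homology_field:
  assumes "reduced_homology_is_field TYPE('k::field) i \<Delta>"
    and no: "simplicial_chains (i + 1) \<Delta> = {\<lambda>_. 0 :: 'k}"
  shows "fun_space.dim (simplicial_cycles i \<Delta> :: ('a list \<Rightarrow> 'k) set) = 1"
proof -
  have B: "simplicial_boundaries i \<Delta> = {\<lambda>_. 0 :: 'k}"
    unfolding simplicial_boundaries_def no by (simp add: boundary_map_0)
  have cls: "homology_class i \<Delta> x = {x}" if "x \<in> simplicial_cycles i \<Delta>" for x :: "'a list \<Rightarrow> 'k"
    unfolding homology_class_def homologous_def B using that by (auto simp: fun_eq_iff)
  then have H: "reduced_homology i \<Delta> = (\<lambda>x. {x :: 'a list \<Rightarrow> 'k}) ` simplicial_cycles i \<Delta>"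
    unfolding reduced_homology_def quotient_def homology_class_def by auto
  obtain \<phi> :: "('a list \<Rightarrow> 'k) set \<Rightarrow> 'k" where \<phi>:
    "bij_betw \<phi> (reduced_homology i \<Delta>) UNIV"
    "\<And>a x. x \<in> simplicial_cycles i \<Delta> \<Longrightarrow>
      \<phi> (homology_class i \<Delta> (\<lambda>xs. a * x xs)) = a * \<phi> (homology_class i \<Delta> x)"
    using assms(1) unfolding reduced_homology_is_field_def by blast
  have scale: "(\<lambda>xs. a * x xs) \<in> simplicial_cycles i \<Delta>"
    if "x \<in> simplicial_cycles i \<Delta>" for a and x :: "'a list \<Rightarrow> 'k"
  proof -
    have "boundary_map \<Delta> (\<lambda>xs. a * x xs) = (\<lambda>xs. a * boundary_map \<Delta> x xs)"
      by (simp add: boundary_map_def sum_distrib_left)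
    then show ?thesis
      using that fun_space.subspace_scale[OF simplicial_chains_subspace, of x i \<Delta> a]
      by (simp add: simplicial_cycles_def)
  qed
  obtain x :: "'a list \<Rightarrow> 'k" where x: "x \<in> simplicial_cycles i \<Delta>" "\<phi> {x} = 1"
    using \<phi>(1) unfolding bij_betw_def H by (metis (no_types, lifting) UNIV_I imageE)
  have mult: "\<phi> {\<lambda>xs. a * x xs} = a" for a
    using \<phi>(2)[OF x(1), of a] x scale[OF x(1)] by (simp add: cls)
  have "x \<noteq> (\<lambda>_. 0)"
  proof
    assume "x = (\<lambda>_. 0)"
    then show False using mult[of 0] x(2) by simp
  qed
  have "y \<in> fun_space.span {x}" if y: "y \<in> simplicial_cycles i \<Delta>" for y
  proof -
    have "inj_on \<phi> (reduced_homology i \<Delta>)" using \<phi>(1) by (rule bij_betw_imp_inj_on)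
    moreover have "\<phi> {y} = \<phi> {\<lambda>xs. \<phi> {y} * x xs}" by (simp add: mult)
    moreover have "{y} \<in> reduced_homology i \<Delta>" "{\<lambda>xs. \<phi> {y} * x xs} \<in> reduced_homology i \<Delta>"
      unfolding H using y scale[OF x(1)] by blast+
    ultimately have "{y} = {\<lambda>xs. \<phi> {y} * x xs}" by (rule inj_onD)
    then have "y = (\<lambda>xs. \<phi> {y} * x xs)" by (rule singleton_inject)
    moreover have "(\<lambda>xs. \<phi> {y} * x xs) \<in> fun_space.span {x}"
      by (intro fun_space.span_scale fun_space.span_base) simp
    ultimately show ?thesis by metis
  qed
  then have "fun_space.dim (simplicial_cycles i \<Delta> :: ('a list \<Rightarrow> 'k) set) = card {x}"
    using x \<open>x \<noteq> (\<lambda>_. 0)\<close>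
    by (intro fun_space.dim_unique[of "{x}"]) (auto simp: zero_fun_def)
  then show ?thesis by simp
qed

text \<open>\<open>face_number \<Delta> k\<close> is the dimension of \<open>?Z k\<close> plus that
  of the boundaries of \<open>?C k\<close>, and vanishing homology makes the latter
  \<open>?Z (k - 1)\<close>. The alternating sum telescopes to the dimension of \<open>?Z d\<close>,
  which is 1. The index \<open>k\<close> is a cardinality, so degrees are shifted by one.\<close>

lemma euler_poincare:
  fixes \<Delta> :: "'a set set"
  assumes \<Delta>: "simplicial_complex \<Delta>" and d: "\<And>f. f \<in> \<Delta> \<Longrightarrow> card f \<le> d"
    and zero: "\<And>i. i < int d - 1 \<Longrightarrow> reduced_homology_is_zero TYPE('k::field) i \<Delta>"
    and fld: "reduced_homology_is_field TYPE('k) (int d - 1) \<Delta>"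
  shows "(\<Sum>f\<in>\<Delta>. (-1) ^ (d - card f)) = (1 :: int)"
proof -
  let ?C = "\<lambda>k. simplicial_chains (int k - 1) \<Delta> :: ('a list \<Rightarrow> 'k) set"
  let ?Z = "\<lambda>k. simplicial_cycles (int k - 1) \<Delta> :: ('a list \<Rightarrow> 'k) set"
  have fin: "finite \<Delta>" "\<And>f. f \<in> \<Delta> \<Longrightarrow> finite f"
    using \<Delta> unfolding simplicial_complex_def vertices_def by (auto dest: finite_UnionD intro: finite_subset)
  have rn: "face_number \<Delta> k = fun_space.dim (?Z k) + fun_space.dim (boundary_map \<Delta> ` ?C k)" for k
  proof -
    obtain B :: "('a list \<Rightarrow> 'k) set" where B: "finite B" "?C k \<subseteq> fun_space.span B"
      "fun_space.dim (?C k) = face_number \<Delta> k" using dim_simplicial_chains[OF \<Delta>] .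
    have "?Z k = {x \<in> ?C k. boundary_map \<Delta> x = 0}"
      by (auto simp: simplicial_cycles_def zero_fun_def)
    then show ?thesis
      using fun_space.dim_kernel_image[OF boundary_map_linear simplicial_chains_subspace B(1,2)] B(3)
      by simp
  qed
  \<comment> \<open>The boundary reads \<open>c\<close> at nonempty lists only, where a chain in
    \<open>?C 0\<close> vanishes.\<close>
  have C0: "fun_space.dim (boundary_map \<Delta> ` ?C 0) = 0"
  proof -
    have "boundary_map \<Delta> c = 0" if c: "c \<in> ?C 0" for c
    proof -
      have "c (v # ys) = 0" for v ys
        using simplicial_chainsD(3)[OF c, of "v # ys"] by fastforce
      then show ?thesis by (simp add: boundary_map_def zero_fun_def)
    qed
    then have "boundary_map \<Delta> ` ?C 0 \<subseteq> fun_space.span {}" by auto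
    from fun_space.dim_le_card[OF this] show ?thesis by simp
  qed
  have step: "boundary_map \<Delta> ` ?C (Suc k) = ?Z k" if k: "k < d" for k
  proof
    show "boundary_map \<Delta> ` ?C (Suc k) \<subseteq> ?Z k"
      using boundary_map_chains[OF \<Delta>, of _ "int k - 1"] boundary_boundary
      by (fastforce simp: simplicial_cycles_def zero_fun_def)
    show "?Z k \<subseteq> boundary_map \<Delta> ` ?C (Suc k)"
      using homology_zero_cycles[OF zero, of "int k - 1"] k
      by (auto simp: simplicial_boundaries_def)
  qed
  have alt: "(\<Sum>k\<le>m. (-1) ^ k * int (face_number \<Delta> k)) = (-1) ^ m * int (fun_space.dim (?Z m))" if "m \<le> d" for m
    using that
  proof (induction m)
    case 0
    then show ?case using rn[of 0] C0 by simp
  next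
    case (Suc m)
    then show ?case using rn[of "Suc m"] step[of m] by (simp add: algebra_simps)
  qed
  have "simplicial_chains (int d - 1 + 1) \<Delta> = {\<lambda>_. 0 :: 'k}"
  proof -
    have "c xs = 0" if c: "c \<in> simplicial_chains (int d) \<Delta>" for c :: "'a list \<Rightarrow> 'k" and xs
    proof (rule ccontr)
      assume "c xs \<noteq> 0"
      from simplicial_chainsD[OF c this] show False
        using d[of "set xs"] distinct_card[of xs] by simp
    qed
    then show ?thesis using zero_chain by (auto simp: fun_eq_iff)
  qed
  from dim_cycles_of_homology_field[OF fld this] have "fun_space.dim (?Z d) = 1" .
  then have "(-1) ^ d * (\<Sum>k\<le>d. (-1) ^ k * int (face_number \<Delta> k)) = 1"
    using alt[of d] by (simp flip: power_mult_distrib)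
  moreover have "(\<Sum>f\<in>\<Delta>. (-1) ^ (d - card f)) = (\<Sum>k\<le>d. \<Sum>f | f \<in> \<Delta> \<and> card f = k. (-1) ^ (d - card f) :: int)"
    by (rule sum.group[symmetric]) (use fin d in auto)
  moreover have "(\<Sum>f | f \<in> \<Delta> \<and> card f = k. (-1) ^ (d - card f)) = (-1) ^ d * ((-1) ^ k * int (face_number \<Delta> k))" if "k \<le> d" for k
  proof -
    have "(-1) ^ (d - k) = ((-1) ^ d * (-1) ^ k :: int)"
      using that by (simp add: minus_one_power_iff)
    then show ?thesis by (simp add: face_number_def)
  qed
  ultimately show ?thesis by (simp add: sum_distrib_left)
qed

text \<open>If \<open>w\<close> lay outside \<open>U\<close>, the cycle \<open>[u] - [w]\<close>
  would be the boundary of a 1-chain \<open>e\<close>. Summed over \<open>U\<close>, that boundary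
  meets only edges inside \<open>U\<close>, where antisymmetry gives 0, but \<open>[u] - [w]\<close>
  gives 1.\<close>

lemma connected_of_homology_zero:
  assumes \<Delta>: "simplicial_complex \<Delta>" and H: "reduced_homology_is_zero TYPE('k::field) 0 \<Delta>"
    and U: "U \<subseteq> vertices \<Delta>" "u \<in> U" "\<And>x y. x \<in> U \<Longrightarrow> {x, y} \<in> \<Delta> \<Longrightarrow> y \<in> U"
  shows "U = vertices \<Delta>"
proof (rule ccontr)
  assume "U \<noteq> vertices \<Delta>"
  then obtain w where w: "w \<in> vertices \<Delta>" "w \<notin> U" using U(1) by auto
  have fin: "finite (vertices \<Delta>)" using \<Delta> by (simp add: simplicial_complex_def)
  have vert: "{x} \<in> \<Delta>" if "x \<in> vertices \<Delta>" for x
    using that \<Delta> by (auto simp: simplicial_complex_def vertices_def)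
  define c :: "'a list \<Rightarrow> 'k" where
    "c xs = (if xs = [u] then 1 else if xs = [w] then -1 else 0)" for xs
  have uw: "u \<noteq> w" "u \<in> vertices \<Delta>" using U w by auto
  have "c \<in> simplicial_chains 0 \<Delta>"
    using vert uw w by (auto simp: simplicial_chains_def c_def Cons_eq_append_conv split: if_splits)
  moreover have "boundary_map \<Delta> c = (\<lambda>_. 0)"
  proof
    fix ys
    show "boundary_map \<Delta> c ys = 0"
    proof (cases "ys = []")
      case True
      have "(\<Sum>v\<in>vertices \<Delta>. c [v]) = (\<Sum>v\<in>vertices \<Delta>. (if v = u then 1 else 0) + (if v = w then - 1 else 0))"
        using uw by (intro sum.cong) (auto simp: c_def)
      also have "\<dots> = 0" using fin uw w by (simp add: sum.distrib)
      finally show ?thesis using True by (simp add: boundary_map_def)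
    qed (simp add: boundary_map_def c_def)
  qed
  ultimately have "c \<in> simplicial_boundaries 0 \<Delta>"
    using homology_zero_cycles[OF H] by (simp add: simplicial_cycles_def)
  then obtain e where e: "e \<in> simplicial_chains 1 \<Delta>" "c = boundary_map \<Delta> e"
    by (auto simp: simplicial_boundaries_def)
  have "(\<Sum>y\<in>U. c [y]) = (\<Sum>y\<in>U. \<Sum>v\<in>vertices \<Delta>. e [v, y])"
    unfolding e(2) boundary_map_def ..
  also have "\<dots> = (\<Sum>y\<in>U. \<Sum>v\<in>U. e [v, y])"
  proof (rule sum.cong[OF refl], rule sum.mono_neutral_right[OF fin U(1)], rule ballI)
    fix y v assume "y \<in> U" "v \<in> vertices \<Delta> - U"
    then show "e [v, y] = 0"
      using simplicial_chainsD(2)[OF e(1), of "[v, y]"] U(3)[of y v] by (auto simp: insert_commute)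
  qed
  also have "\<dots> = 0"
  proof (rule sum_antisymmetric_eq_0)
    show "e [y, x] = - e [x, y]" for x y
      using simplicial_chains_swap[OF e(1), of "[]" y x "[]"] by simp
    show "e [x, x] = 0" for x
      using simplicial_chainsD(1)[OF e(1), of "[x, x]"] by auto
  qed
  finally have "(\<Sum>y\<in>U. c [y]) = 0" .
  moreover have "(\<Sum>y\<in>U. c [y]) = (\<Sum>y\<in>U. if y = u then 1 else 0)"
    using w by (intro sum.cong) (auto simp: c_def)
  ultimately show False using finite_subset[OF U(1) fin] U(2) by simp
qed

section \<open>Flag homology spheres\<close>

text \<open>\<open>{x, x}\<close> is a singleton and so a face at every vertex;
  \<open>x \<noteq> y\<close> keeps the graph loopless.\<close>

definition adj :: "'a set set \<Rightarrow> 'a \<Rightarrow> 'a \<Rightarrow> bool" where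
  "adj \<Delta> x y \<longleftrightarrow> x \<noteq> y \<and> {x, y} \<in> \<Delta>"

interpretation adj: sgraph "adj \<Delta>" for \<Delta>
  by unfold_locales (auto simp: adj_def insert_commute)

section \<open>Faces and links in flag complexes\<close>

lemma simplicial_complexD:
  assumes "simplicial_complex \<Delta>"
  shows "finite (vertices \<Delta>)" "{} \<in> \<Delta>" "\<And>f g. f \<in> \<Delta> \<Longrightarrow> g \<subseteq> f \<Longrightarrow> g \<in> \<Delta>"
    "finite \<Delta>" "\<And>f. f \<in> \<Delta> \<Longrightarrow> finite f"
  using assms unfolding simplicial_complex_def vertices_def
  by (auto dest: finite_UnionD intro: finite_subset)

text \<open>A smallest clique that is not a face would be a minimal non-face, hence a pair, but the
  pairs in a clique are faces.\<close>

lemma flag_clique: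
  assumes \<Delta>: "simplicial_complex \<Delta>" "flag \<Delta>"
    and F: "F \<subseteq> vertices \<Delta>" "\<And>x y. x \<in> F \<Longrightarrow> y \<in> F \<Longrightarrow> x \<noteq> y \<Longrightarrow> {x, y} \<in> \<Delta>"
  shows "F \<in> \<Delta>"
proof -
  have "finite F" using F(1) simplicial_complexD(1)[OF \<Delta>(1)] by (rule finite_subset)
  then show ?thesis using F
  proof (induction F rule: finite_psubset_induct)
    case (psubset F)
    show ?case
    proof (rule ccontr)
      assume F: "F \<notin> \<Delta>"
      have "g \<in> \<Delta>" if "g \<subset> F" for g
        using psubset.IH[OF that] psubset.prems that by blast
      then have "minimal_nonface \<Delta> F"
        using psubset.prems F by (simp add: minimal_nonface_def)
      then have "card F = 2" using \<Delta>(2) by (simp add: flag_def)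
      then obtain x y where "F = {x, y}" "x \<noteq> y" by (auto simp: card_2_iff)
      then show False using psubset.prems(2)[of x y] F by simp
    qed
  qed
qed

lemma vertices_link:
  assumes "simplicial_complex \<Delta>"
  shows "vertices (link \<Delta> f) = {v. v \<notin> f \<and> insert v f \<in> \<Delta>}"
proof (intro equalityI subsetI)
  fix v assume "v \<in> vertices (link \<Delta> f)"
  then obtain g where g: "v \<in> g" "g \<inter> f = {}" "g \<union> f \<in> \<Delta>"
    by (auto simp: vertices_def link_def)
  then have "insert v f \<in> \<Delta>" using simplicial_complexD(3)[OF assms g(3)] by auto
  then show "v \<in> {v. v \<notin> f \<and> insert v f \<in> \<Delta>}" using g by auto
next
  fix v assume v: "v \<in> {v. v \<notin> f \<and> insert v f \<in> \<Delta>}"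
  then have "{v} \<in> link \<Delta> f"
    using simplicial_complexD(3)[OF assms, of "insert v f" "{v}"] by (simp add: link_def)
  then show "v \<in> vertices (link \<Delta> f)" by (auto simp: vertices_def)
qed

lemma link_simplicial_complex:
  assumes "simplicial_complex \<Delta>" "f \<in> \<Delta>"
  shows "simplicial_complex (link \<Delta> f)"
proof -
  have "vertices (link \<Delta> f) \<subseteq> vertices \<Delta>" by (auto simp: vertices_def link_def)
  then have "finite (vertices (link \<Delta> f))"
    using simplicial_complexD(1)[OF assms(1)] finite_subset by blast
  moreover have "h \<in> link \<Delta> f" if "g \<in> link \<Delta> f" "h \<subseteq> g" for g h
    using that simplicial_complexD(3)[OF assms(1), of g h]
      simplicial_complexD(3)[OF assms(1), of "g \<union> f" "h \<union> f"]
    by (auto simp: link_def)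
  moreover have "{} \<in> link \<Delta> f"
    using assms simplicial_complexD(2)[OF assms(1)] by (simp add: link_def)
  ultimately show ?thesis unfolding simplicial_complex_def by blast
qed

lemma pure_face_extends:
  assumes "simplicial_complex \<Delta>" "pure_of_dim (int d - 1) \<Delta>" "f \<in> \<Delta>"
  shows "\<exists>g\<in>\<Delta>. f \<subseteq> g \<and> card g = d"
proof -
  obtain g where g: "g \<in> \<Delta>" "f \<subseteq> g" "\<forall>h\<in>\<Delta>. g \<subseteq> h \<longrightarrow> g = h"
    using finite_has_maximal2[OF simplicial_complexD(4)[OF assms(1)] assms(3)] by blast
  then have "maximal_face \<Delta> g" by (auto simp: maximal_face_def)
  then have "card g = d" using assms(2) by (auto simp: pure_of_dim_def)
  then show ?thesis using g by blast
qed

lemma pure_card_le: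
  assumes "simplicial_complex \<Delta>" "pure_of_dim (int d - 1) \<Delta>" "f \<in> \<Delta>"
  shows "card f \<le> d"
proof -
  obtain g where "g \<in> \<Delta>" "f \<subseteq> g" "card g = d" using pure_face_extends[OF assms] by blast
  then show ?thesis using card_mono simplicial_complexD(5)[OF assms(1)] by blast
qed

section \<open>Symmetry and pseudomanifold structure of spheres\<close>

lemma link_euler:
  assumes S: "homology_sphere TYPE('k::field) (int d - 1) \<Delta>" and f: "f \<in> \<Delta>"
  shows "(\<Sum>g\<in>link \<Delta> f. (-1) ^ (d - card f - card g)) = (1 :: int)"
proof -
  have \<Delta>: "simplicial_complex \<Delta>" "pure_of_dim (int d - 1) \<Delta>"
    using S by (auto simp: homology_sphere_def)
  have d: "int (d - card f) - 1 = int d - 1 - int (card f)"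
    using pure_card_le[OF \<Delta> f] by simp
  show ?thesis
  proof (rule euler_poincare)
    show "simplicial_complex (link \<Delta> f)" using \<Delta>(1) f by (rule link_simplicial_complex)
    show "card g \<le> d - card f" if g: "g \<in> link \<Delta> f" for g
    proof -
      have "card (g \<union> f) = card g + card f"
        using g f simplicial_complexD(5)[OF \<Delta>(1)] by (intro card_Un_disjoint) (auto simp: link_def)
      moreover have "card (g \<union> f) \<le> d" using g pure_card_le[OF \<Delta>] by (simp add: link_def)
      ultimately show ?thesis by simp
    qed
    show "reduced_homology_is_zero TYPE('k) i (link \<Delta> f)" if "i < int (d - card f) - 1" for i
      using S f that unfolding d homology_sphere_def by blast
    show "reduced_homology_is_field TYPE('k) (int (d - card f) - 1) (link \<Delta> f)"
      using S f unfolding d homology_sphere_def by blast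
  qed
qed

text \<open>Adding \<open>f\<close> maps its link bijectively onto the faces containing
  \<open>f\<close>, so the Euler characteristics of links supply the hypothesis of
  \<open>dehn_sommerville\<close>.\<close>

lemma h_poly_sphere_symmetric:
  assumes S: "homology_sphere TYPE('k::field) (int d - 1) \<Delta>"
  shows "degree (h_poly d \<Delta>) \<le> d"
    and "i \<le> d \<Longrightarrow> coeff (h_poly d \<Delta>) i = coeff (h_poly d \<Delta>) (d - i)"
proof -
  have \<Delta>: "simplicial_complex \<Delta>" "pure_of_dim (int d - 1) \<Delta>"
    using S by (auto simp: homology_sphere_def)
  have euler: "(\<Sum>g | g \<in> \<Delta> \<and> f \<subseteq> g. (-1) ^ (d - card g)) = (1 :: int)" if f: "f \<in> \<Delta>" for f
  proof -
    have bij: "bij_betw (\<lambda>g. g \<union> f) (link \<Delta> f) {g \<in> \<Delta>. f \<subseteq> g}"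
    proof (rule bij_betw_byWitness[where f' = "\<lambda>g. g - f"])
      show "(\<lambda>g. g - f) ` {g \<in> \<Delta>. f \<subseteq> g} \<subseteq> link \<Delta> f"
        using simplicial_complexD(3)[OF \<Delta>(1)] by (auto simp: link_def Un_absorb2)
    qed (auto simp: link_def)
    have card: "card (g \<union> f) = card f + card g" if "g \<in> link \<Delta> f" for g
      using that f simplicial_complexD(5)[OF \<Delta>(1)]
      by (subst card_Un_disjoint) (auto simp: link_def)
    have "(\<Sum>g | g \<in> \<Delta> \<and> f \<subseteq> g. (-1) ^ (d - card g)) =
        (\<Sum>g\<in>link \<Delta> f. (-1) ^ (d - card (g \<union> f)) :: int)"
      by (rule sum.reindex_bij_betw[OF bij, symmetric])
    also have "\<dots> = (\<Sum>g\<in>link \<Delta> f. (-1) ^ (d - card f - card g))"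
      by (intro sum.cong) (simp_all add: card)
    finally show ?thesis using link_euler[OF S f] by simp
  qed
  have fin: "finite f \<and> card f \<le> d" if "f \<in> \<Delta>" for f
    using pure_card_le[OF \<Delta> that] simplicial_complexD(5)[OF \<Delta>(1) that] by simp
  note ds = dehn_sommerville[OF simplicial_complexD(4)[OF \<Delta>(1)] fin simplicial_complexD(3)[OF \<Delta>(1)] euler]
  show "degree (h_poly d \<Delta>) \<le> d" by (rule ds(1))
  show "i \<le> d \<Longrightarrow> coeff (h_poly d \<Delta>) i = coeff (h_poly d \<Delta>) (d - i)" by (rule ds(2))
qed

text \<open>Induction on \<open>d - card f\<close> over all links: a neighbourhood inside the link
  of \<open>f\<close> is the vertex set of the link of a larger face. In codimension one the Euler
  characteristic leaves two vertices; for smaller faces vanishing homology in degree 0 gives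
  connectedness.\<close>

lemma flag_sphere_npm:
  assumes S: "flag_homology_sphere TYPE('k::field) (int d - 1) \<Delta>"
  shows "adj.npm \<Delta> d (vertices \<Delta>)"
proof -
  have hs: "homology_sphere TYPE('k) (int d - 1) \<Delta>" "flag \<Delta>"
    and \<Delta>: "simplicial_complex \<Delta>" "pure_of_dim (int d - 1) \<Delta>"
    using S by (auto simp: flag_homology_sphere_def homology_sphere_def)
  note down = simplicial_complexD(3)[OF \<Delta>(1)]
  \<comment> \<open>Flagness: vertices of the link of \<open>f\<close> that are adjacent in
    \<open>\<Delta>\<close> are adjacent in the link, so the one relation
    \<open>adj \<Delta>\<close> serves for all links.\<close>
  have pair: "insert w (insert v f) \<in> \<Delta>"
    if "insert v f \<in> \<Delta>" "insert w f \<in> \<Delta>" "{v, w} \<in> \<Delta>" for v w f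
  proof (rule flag_clique[OF \<Delta>(1) hs(2)])
    show "insert w (insert v f) \<subseteq> vertices \<Delta>" using that by (auto simp: vertices_def)
    fix x y assume "x \<in> insert w (insert v f)" "y \<in> insert w (insert v f)" "x \<noteq> y"
    then have "{x, y} \<subseteq> insert v f \<or> {x, y} \<subseteq> insert w f \<or> {x, y} \<subseteq> {v, w}" by auto
    then show "{x, y} \<in> \<Delta>" using that down by blast
  qed
  have "adj.npm \<Delta> (d - card f) (vertices (link \<Delta> f))" if "f \<in> \<Delta>" for f
    using that
  proof (induction "d - card f" arbitrary: f rule: less_induct)
    case less
    note f = \<open>f \<in> \<Delta>\<close>
    have finf: "finite f" using simplicial_complexD(5)[OF \<Delta>(1) f] .
    have ins: "card (insert v f) = Suc (card f)" if "v \<notin> f" for v using that finf by simp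
    note V = vertices_link[OF \<Delta>(1)]
    have fle: "card f \<le> d" using pure_card_le[OF \<Delta> f] .
    consider "d - card f = 0" | "d - card f = Suc 0" | m where "d - card f = Suc (Suc m)"
      by (metis not0_implies_Suc)
    then show ?case
    proof cases
      case 1
      have "vertices (link \<Delta> f) = {}"
        using pure_card_le[OF \<Delta>] ins 1 fle unfolding V by fastforce
      then show ?thesis using 1 by simp
    next
      case 2
      let ?V = "vertices (link \<Delta> f)"
      have nonadj: "{a, b} \<notin> \<Delta>" if "a \<in> ?V" "b \<in> ?V" "a \<noteq> b" for a b
      proof
        assume "{a, b} \<in> \<Delta>"
        then have "insert b (insert a f) \<in> \<Delta>" using pair that unfolding V by blast
        from pure_card_le[OF \<Delta> this] show False
          using that ins[of a] 2 finf unfolding V by simp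
      qed
      have "link \<Delta> f = insert {} ((\<lambda>v. {v}) ` ?V)"
      proof (intro equalityI subsetI)
        fix g assume g: "g \<in> link \<Delta> f"
        then have sub: "g \<subseteq> ?V" by (auto simp: vertices_def)
        show "g \<in> insert {} ((\<lambda>v. {v}) ` ?V)"
        proof (cases "\<exists>a b. a \<in> g \<and> b \<in> g \<and> a \<noteq> b")
          case True
          then obtain a b where ab: "a \<in> g" "b \<in> g" "a \<noteq> b" by blast
          then have "{a, b} \<in> \<Delta>" using g down[of g "{a, b}"] by (auto simp: link_def)
          then show ?thesis using nonadj ab sub by blast
        next
          case False
          then have "g = {} \<or> (\<exists>v. g = {v})" by blast
          then show ?thesis using sub by auto
        qed
      next
        fix g assume "g \<in> insert {} ((\<lambda>v. {v}) ` ?V)"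
        then show "g \<in> link \<Delta> f"
          using f down[of f "{}"] down unfolding V by (auto simp: link_def)
      qed
      \<comment> \<open>The empty face contributes -1 and every vertex 1, so there are two
        vertices.\<close>
      then have "(1 :: int) = (\<Sum>g\<in>insert {} ((\<lambda>v. {v}) ` ?V). (-1) ^ (d - card f - card g))"
        using link_euler[OF hs(1) f] by simp
      also have "\<dots> = - 1 + (\<Sum>v\<in>?V. 1)"
        using simplicial_complexD(1)[OF link_simplicial_complex[OF \<Delta>(1) f]]
        by (subst sum.insert) (auto simp: 2 sum.reindex)
      finally have "card ?V = 2" by simp
      then obtain a b where "?V = {a, b}" "a \<noteq> b" by (auto simp: card_2_iff)
      moreover from this have "\<not> adj \<Delta> a b" using nonadj by (simp add: adj_def)
      ultimately show ?thesis unfolding 2 by auto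
    next
      case 3
      let ?V = "vertices (link \<Delta> f)"
      obtain g where g: "g \<in> \<Delta>" "f \<subseteq> g" "card g = d" using pure_face_extends[OF \<Delta> f] by blast
      then have "f \<noteq> g" using 3 by auto
      then obtain v where "v \<in> g" "v \<notin> f" using g by auto
      then have "?V \<noteq> {}" using down[OF g(1), of "insert v f"] g unfolding V by auto
      moreover have "adj.npm \<Delta> (Suc m) (adj.nbrs \<Delta> ?V v)" if v: "v \<in> ?V" for v
      proof -
        have "v \<notin> f" "insert v f \<in> \<Delta>" using v unfolding V by auto
        have "adj.nbrs \<Delta> ?V v = vertices (link \<Delta> (insert v f))"
          unfolding adj.nbrs_def V
        proof (intro equalityI subsetI)
          fix w assume "w \<in> {w \<in> {v. v \<notin> f \<and> insert v f \<in> \<Delta>}. adj \<Delta> v w}"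
          then show "w \<in> {w. w \<notin> insert v f \<and> insert w (insert v f) \<in> \<Delta>}"
            using pair[OF \<open>insert v f \<in> \<Delta>\<close>, of w] by (auto simp: adj_def)
        next
          fix w assume w: "w \<in> {w. w \<notin> insert v f \<and> insert w (insert v f) \<in> \<Delta>}"
          then have "insert w f \<in> \<Delta>" "{v, w} \<in> \<Delta>"
            using down[of "insert w (insert v f)" "insert w f"] down[of "insert w (insert v f)" "{v, w}"]
            by auto
          then show "w \<in> {w \<in> {v. v \<notin> f \<and> insert v f \<in> \<Delta>}. adj \<Delta> v w}"
            using w by (auto simp: adj_def)
        qed
        moreover have "d - card (insert v f) = Suc m" using ins[OF \<open>v \<notin> f\<close>] 3 by simp
        ultimately show ?thesis
          using less.hyps[of "insert v f"] 3 \<open>insert v f \<in> \<Delta>\<close> by simp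
      qed
      moreover have "adj.connected_on \<Delta> ?V"
        unfolding adj.connected_on_def
      proof (intro allI impI)
        fix U assume U: "U \<subseteq> ?V" "U \<noteq> {}" "\<forall>u\<in>U. \<forall>w\<in>?V. adj \<Delta> u w \<longrightarrow> w \<in> U"
        then obtain u where u: "u \<in> U" by blast
        \<comment> \<open>The link has dimension at least one, so degree 0 lies below the top
          degree.\<close>
        have "0 < int d - 1 - int (card f)" using 3 by simp
        then have "reduced_homology_is_zero TYPE('k) 0 (link \<Delta> f)"
          using hs(1) f unfolding homology_sphere_def by blast
        then show "U = ?V"
        proof (rule connected_of_homology_zero[OF link_simplicial_complex[OF \<Delta>(1) f] _ U(1) u])
          fix x y assume xy: "x \<in> U" "{x, y} \<in> link \<Delta> f"
          then have "y \<in> ?V" "{x, y} \<in> \<Delta>" by (auto simp: vertices_def link_def)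
          then show "y \<in> U" using U(3) xy(1) by (cases "x = y") (auto simp: adj_def)
        qed
      qed
      ultimately show ?thesis unfolding 3 by simp
    qed
  qed
  from this[OF simplicial_complexD(2)[OF \<Delta>(1)]] show ?thesis by (simp add: link_def)
qed

section \<open>Realising decompositions as joins\<close>

lemma antipodes_eq_nonnbrs: "antipodes \<Delta> v = adj.nonnbrs \<Delta> (vertices \<Delta>) v"
  by (auto simp: antipodes_def adj.nonnbrs_def adj_def)

lemma vertices_join:
  assumes "{} \<in> \<Gamma>" "{} \<in> \<Lambda>"
  shows "vertices (join \<Gamma> \<Lambda>) = vertices \<Gamma> <+> vertices \<Lambda>"
  using assms by (fastforce simp: vertices_def join_def)

text \<open>\<open>A\<close> and \<open>C\<close> can be matched with their factors separately:
  \<open>down\<close> splits each face into its two traces and \<open>join\<close> reassembles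
  them.\<close>

lemma isomorphic_joinI:
  assumes down: "\<And>f g. f \<in> \<Delta> \<Longrightarrow> g \<subseteq> f \<Longrightarrow> g \<in> \<Delta>"
    and V: "vertices \<Delta> = A \<union> C" "A \<inter> C = {}"
    and join: "\<And>f g. f \<subseteq> A \<Longrightarrow> g \<subseteq> C \<Longrightarrow> f \<in> \<Delta> \<Longrightarrow> g \<in> \<Delta> \<Longrightarrow> f \<union> g \<in> \<Delta>"
    and \<theta>: "bij_betw \<theta> A (vertices \<Gamma>)" "\<And>f. f \<subseteq> A \<Longrightarrow> f \<in> \<Delta> \<longleftrightarrow> \<theta> ` f \<in> \<Gamma>"
    and \<eta>: "bij_betw \<eta> C (vertices \<Lambda>)" "\<And>g. g \<subseteq> C \<Longrightarrow> g \<in> \<Delta> \<longleftrightarrow> \<eta> ` g \<in> \<Lambda>"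
    and empty: "{} \<in> \<Gamma>" "{} \<in> \<Lambda>"
  shows "isomorphic_complexes \<Delta> (join \<Gamma> \<Lambda>)"
proof -
  define \<psi> where "\<psi> x = (if x \<in> A then Inl (\<theta> x) else Inr (\<eta> x))" for x
  have img: "\<psi> ` (f \<union> g) = \<theta> ` f <+> \<eta> ` g" if "f \<subseteq> A" "g \<subseteq> C" for f g
    using that V(2) by (auto simp: \<psi>_def Plus_def image_iff)
  have "\<psi> ` vertices \<Delta> = vertices (join \<Gamma> \<Lambda>)"
    using img[of A C] \<theta>(1) \<eta>(1) V(1) vertices_join[OF empty] by (simp add: bij_betw_def)
  moreover have "inj_on \<psi> (vertices \<Delta>)"
    using \<theta>(1) \<eta>(1) unfolding V(1) by (auto simp: inj_on_def \<psi>_def bij_betw_def)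
  moreover have "(\<lambda>f. \<psi> ` f) ` \<Delta> = join \<Gamma> \<Lambda>"
  proof (intro equalityI subsetI)
    fix X assume "X \<in> (\<lambda>f. \<psi> ` f) ` \<Delta>"
    then obtain f where f: "f \<in> \<Delta>" "X = \<psi> ` f" by auto
    have "f = (f \<inter> A) \<union> (f \<inter> C)" using f V by (auto simp: vertices_def)
    then have "X = \<theta> ` (f \<inter> A) <+> \<eta> ` (f \<inter> C)" using img[of "f \<inter> A" "f \<inter> C"] f by simp
    moreover have "\<theta> ` (f \<inter> A) \<in> \<Gamma>" "\<eta> ` (f \<inter> C) \<in> \<Lambda>"
      using \<theta>(2)[of "f \<inter> A"] \<eta>(2)[of "f \<inter> C"] down[OF f(1)] by auto
    ultimately show "X \<in> join \<Gamma> \<Lambda>" unfolding join_def by blast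
  next
    fix X assume "X \<in> join \<Gamma> \<Lambda>"
    then obtain f g where fg: "X = f <+> g" "f \<in> \<Gamma>" "g \<in> \<Lambda>" by (auto simp: join_def)
    have "f \<subseteq> \<theta> ` A" "g \<subseteq> \<eta> ` C"
      using fg \<theta>(1) \<eta>(1) by (auto simp: bij_betw_def vertices_def)
    then obtain f' g' where "f' \<subseteq> A" "f = \<theta> ` f'" "g' \<subseteq> C" "g = \<eta> ` g'"
      by (meson subset_imageE)
    then have "X = \<psi> ` (f' \<union> g')" "f' \<union> g' \<in> \<Delta>"
      using fg img join \<theta>(2) \<eta>(2) by auto
    then show "X \<in> (\<lambda>f. \<psi> ` f) ` \<Delta>" by blast
  qed
  ultimately show ?thesis unfolding isomorphic_complexes_def bij_betw_def by blast
qed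

text \<open>\<open>\<eta>\<close> inverts a cyclic enumeration \<open>p\<close> of \<open>C\<close>.
  Faces inside \<open>C\<close> have at most two vertices because the two neighbours in
  \<open>C\<close> of a vertex are not adjacent.\<close>

lemma cycle_isomorphism:
  assumes C: "finite C" "C \<noteq> {}" "adj.two_regular \<Delta> C" "adj.connected_on \<Delta> C"
    and \<Delta>: "simplicial_complex \<Delta>" "C \<subseteq> vertices \<Delta>"
  obtains \<eta> where "bij_betw \<eta> C {..<card C}"
    "\<And>f. f \<subseteq> C \<Longrightarrow> f \<in> \<Delta> \<longleftrightarrow> \<eta> ` f \<in> cycle_complex (card C)"
proof -
  define k where "k = card C"
  have k: "0 < k" using C by (simp add: k_def card_gt_0_iff)
  obtain p where p: "bij_betw p {..<k} C"
    "\<And>i. i < k \<Longrightarrow> adj.nbrs \<Delta> C (p i) = {p (Suc i mod k), p ((i + k - 1) mod k)}"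
    using adj.two_regular_connected_is_cycle[OF C] unfolding k_def by blast
  have pC: "p i \<in> C" if "i < k" for i using p(1) that by (auto simp: bij_betw_def)
  have inj: "inj_on p {..<k}" using p(1) by (simp add: bij_betw_def)
  have main: "p ` I \<in> \<Delta> \<longleftrightarrow> I \<in> cycle_complex k" if I: "I \<subseteq> {..<k}" for I
  proof
    assume "I \<in> cycle_complex k"
    then consider "I = {}" | i where "i < k" "I = {i}" | i where "i < k" "I = {i, Suc i mod k}"
      by (auto simp: cycle_complex_def)
    then show "p ` I \<in> \<Delta>"
    proof cases
      case 2
      then have "p i \<in> vertices \<Delta>" using pC \<Delta>(2) by blast
      then show ?thesis
        using 2 simplicial_complexD(3)[OF \<Delta>(1)] by (auto simp: vertices_def)
    next
      case 3
      then have "p (Suc i mod k) \<in> adj.nbrs \<Delta> C (p i)" using p(2) by blast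
      then show ?thesis using 3 by (simp add: adj.nbrs_def adj_def)
    qed (use simplicial_complexD(2)[OF \<Delta>(1)] in simp)
  next
    assume face: "p ` I \<in> \<Delta>"
    have adj: "p j \<in> adj.nbrs \<Delta> C (p i)" if "i \<in> I" "j \<in> I" "i \<noteq> j" for i j
    proof -
      have "i < k" "j < k" using that I by auto
      moreover have "p i \<noteq> p j" using inj_onD[OF inj] that I by blast
      moreover have "{p i, p j} \<in> \<Delta>"
        using simplicial_complexD(3)[OF \<Delta>(1) face, of "{p i, p j}"] that by auto
      ultimately show ?thesis using pC by (simp add: adj.nbrs_def adj_def)
    qed
    show "I \<in> cycle_complex k"
    proof (cases "\<exists>i j. i \<in> I \<and> j \<in> I \<and> i \<noteq> j")
      case False
      then have "I = {} \<or> (\<exists>i. I = {i})" by blast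
      then show ?thesis using I by (auto simp: cycle_complex_def)
    next
      case True
      then obtain i j where ij: "i \<in> I" "j \<in> I" "i \<noteq> j" by blast
      have lt: "i < k" "j < k" using ij I by auto
      \<comment> \<open>A third index \<open>l\<close> would make \<open>p j\<close> and
        \<open>p l\<close> adjacent neighbours of \<open>p i\<close>.\<close>
      have "l = i \<or> l = j" if l: "l \<in> I" for l
      proof (rule ccontr)
        assume ne: "\<not> ?thesis"
        obtain x y where xy: "\<not> adj \<Delta> x y" "adj.nbrs \<Delta> C (p i) = {x, y}"
          using C(3) pC[OF lt(1)] unfolding adj.two_regular_def by blast
        have "p j \<in> {x, y}" "p l \<in> {x, y}"
          using adj[OF ij] adj[OF ij(1) l] ne xy by auto
        moreover have "adj \<Delta> (p j) (p l)" using adj[OF ij(2) l] ne by (auto simp: adj.nbrs_def)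
        ultimately show False using xy(1) adj.sym[of \<Delta>] adj.irrefl[of \<Delta>] by auto
      qed
      then have I_eq: "I = {i, j}" using ij by blast
      have "p j = p (Suc i mod k) \<or> p j = p ((i + k - 1) mod k)"
        using adj[OF ij] p(2)[OF lt(1)] by auto
      then have "j = Suc i mod k \<or> j = (i + k - 1) mod k"
        using inj_onD[OF inj] lt k by (metis lessThan_iff mod_less_divisor)
      \<comment> \<open>In the second case \<open>i\<close> is the successor of \<open>j\<close>, so
        the edge is listed under \<open>j\<close>.\<close>
      moreover have "Suc ((i + k - 1) mod k) mod k = i"
        using lt k by (simp add: mod_Suc_eq)
      ultimately have "I = {i, Suc i mod k} \<or> I = {j, Suc j mod k}"
        unfolding I_eq by (metis insert_commute)
      then show ?thesis using lt unfolding cycle_complex_def by blast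
    qed
  qed
  define \<eta> where "\<eta> = the_inv_into {..<k} p"
  have \<eta>: "bij_betw \<eta> C {..<k}" unfolding \<eta>_def using p(1) by (rule bij_betw_the_inv_into)
  moreover have "f \<in> \<Delta> \<longleftrightarrow> \<eta> ` f \<in> cycle_complex k" if f: "f \<subseteq> C" for f
  proof -
    have "p (\<eta> x) = x" if "x \<in> C" for x
      unfolding \<eta>_def using p(1) that by (simp add: f_the_inv_into_f_bij_betw)
    then have "p ` \<eta> ` f = f" using f by (force simp: image_image)
    moreover have "\<eta> ` f \<subseteq> {..<k}" using \<eta> f by (auto simp: bij_betw_def)
    ultimately show ?thesis using main[of "\<eta> ` f"] by simp
  qed
  ultimately show thesis using that unfolding k_def by blast
qed

text \<open>Transfers \<open>circle_factor\<close> from graphs to complexes. The identification of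
  \<open>A\<close> with \<open>\<Gamma>\<close> is left open: it comes from the given suspension in
  part (i) and from \<open>cycle_isomorphism\<close> in part (ii).\<close>

lemma npm_join_decomposition:
  assumes \<Delta>: "simplicial_complex \<Delta>" "flag \<Delta>" and npm: "adj.npm \<Delta> d (vertices \<Delta>)"
    and v0: "v0 \<in> vertices \<Delta>" "num_antipodes \<Delta> v0 = polar_size \<Delta>"
    and a: "a \<in> adj.nbrs \<Delta> (vertices \<Delta>) v0"
      "adj.nonnbrs \<Delta> (adj.nbrs \<Delta> (vertices \<Delta>) v0) a = {b}"
  defines "A \<equiv> adj.nbrs \<Delta> (adj.nbrs \<Delta> (vertices \<Delta>) v0) a"
  shows "\<And>g c. g \<in> A \<Longrightarrow> c \<in> vertices \<Delta> - A \<Longrightarrow> adj \<Delta> g c"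
    and "\<And>\<Gamma> \<theta>. bij_betw \<theta> A (vertices \<Gamma>) \<Longrightarrow>
      (\<And>f. f \<subseteq> A \<Longrightarrow> f \<in> \<Delta> \<longleftrightarrow> \<theta> ` f \<in> \<Gamma>) \<Longrightarrow>
      isomorphic_complexes \<Delta> (join \<Gamma> (cycle_complex (polar_size \<Delta> + 3)))"
proof -
  note fin = simplicial_complexD(1)[OF \<Delta>(1)]
  have min: "card (adj.nonnbrs \<Delta> (vertices \<Delta>) v0) \<le> card (adj.nonnbrs \<Delta> (vertices \<Delta>) v)"
    if "v \<in> vertices \<Delta>" for v
    using v0(2) fin that unfolding polar_size_def num_antipodes_def antipodes_eq_nonnbrs by simp
  note cf = adj.circle_factor[OF npm fin v0(1) min a, folded A_def]
  show join: "adj \<Delta> g c" if "g \<in> A" "c \<in> vertices \<Delta> - A" for g c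
    using cf(1) that by blast
  fix \<Gamma> :: "'b set set" and \<theta>
  assume \<theta>: "bij_betw \<theta> A (vertices \<Gamma>)" "\<And>f. f \<subseteq> A \<Longrightarrow> f \<in> \<Delta> \<longleftrightarrow> \<theta> ` f \<in> \<Gamma>"
  define C where "C = vertices \<Delta> - A"
  have card: "card C = polar_size \<Delta> + 3"
    using cf(4) v0(2) unfolding C_def num_antipodes_def antipodes_eq_nonnbrs by simp
  have AV: "A \<subseteq> vertices \<Delta>" by (auto simp: A_def adj.nbrs_def)
  have "C \<noteq> {}" using card by auto
  obtain \<eta> where \<eta>: "bij_betw \<eta> C {..<card C}"
    "\<And>f. f \<subseteq> C \<Longrightarrow> f \<in> \<Delta> \<longleftrightarrow> \<eta> ` f \<in> cycle_complex (card C)"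
  proof (rule cycle_isomorphism[OF _ \<open>C \<noteq> {}\<close>, of \<Delta>])
    show "adj.two_regular \<Delta> C" "adj.connected_on \<Delta> C" using cf(2,3) by (simp_all add: C_def)
    show "finite C" "C \<subseteq> vertices \<Delta>" using fin by (auto simp: C_def)
  qed (use \<Delta> in auto)
  have verts: "vertices (cycle_complex (card C)) = {..<card C}"
    using card by (intro cycle_complex_faces) simp
  have "isomorphic_complexes \<Delta> (join \<Gamma> (cycle_complex (card C)))"
  proof (rule isomorphic_joinI[OF _ _ _ _ \<theta>])
    show "vertices \<Delta> = A \<union> C" "A \<inter> C = {}" using AV by (auto simp: C_def)
    show "f \<union> g \<in> \<Delta>" if fg: "f \<subseteq> A" "g \<subseteq> C" "f \<in> \<Delta>" "g \<in> \<Delta>" for f g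
    proof (rule flag_clique[OF \<Delta>])
      show "f \<union> g \<subseteq> vertices \<Delta>" using fg by (auto simp: vertices_def)
      fix x y assume "x \<in> f \<union> g" "y \<in> f \<union> g" "x \<noteq> y"
      then consider "{x, y} \<subseteq> f" | "{x, y} \<subseteq> g" | "x \<in> A" "y \<in> C" | "x \<in> C" "y \<in> A"
        using fg by blast
      then show "{x, y} \<in> \<Delta>"
      proof cases
        case 3
        then show ?thesis using join[of x y] by (simp add: adj_def C_def)
      next
        case 4
        then show ?thesis using join[of y x] by (simp add: adj_def C_def insert_commute)
      qed (use fg simplicial_complexD(3)[OF \<Delta>(1)] in blast)+
    qed
    show "bij_betw \<eta> C (vertices (cycle_complex (card C)))" using \<eta>(1) verts by simp
    show "{} \<in> \<Gamma>" using \<theta>(2)[of "{}"] simplicial_complexD(2)[OF \<Delta>(1)] by simp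
    show "{} \<in> cycle_complex (card C)" by (simp add: cycle_complex_def)
  qed (use \<eta>(2) simplicial_complexD(3)[OF \<Delta>(1)] in blast)+
  then show "isomorphic_complexes \<Delta> (join \<Gamma> (cycle_complex (polar_size \<Delta> + 3)))"
    unfolding card .
qed

text \<open>Extracts graph data from the isomorphism: \<open>a\<close> and \<open>b\<close>
  correspond to the poles \<open>Inl False\<close> and \<open>Inl True\<close>, and the vertices
  sent to the right summand are the neighbours of \<open>a\<close> inside the link.\<close>

lemma link_suspension:
  assumes \<Delta>: "simplicial_complex \<Delta>" "flag \<Delta>" and v0: "v0 \<in> vertices \<Delta>"
    and \<Gamma>: "simplicial_complex \<Gamma>"
    and iso: "isomorphic_complexes (link \<Delta> {v0}) (suspension \<Gamma>)"
  defines "N \<equiv> adj.nbrs \<Delta> (vertices \<Delta>) v0"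
  obtains a b \<theta> where "a \<in> N" "adj.nonnbrs \<Delta> N a = {b}"
    "bij_betw \<theta> (adj.nbrs \<Delta> N a) (vertices \<Gamma>)"
    "\<And>f. f \<subseteq> adj.nbrs \<Delta> N a \<Longrightarrow> f \<in> \<Delta> \<longleftrightarrow> \<theta> ` f \<in> \<Gamma>"
proof -
  note down = simplicial_complexD(3)[OF \<Delta>(1)]
  have N: "vertices (link \<Delta> {v0}) = N"
    unfolding vertices_link[OF \<Delta>(1)] N_def
    by (auto simp: adj.nbrs_def adj_def insert_commute) (auto simp: vertices_def)
  \<comment> \<open>By flagness the link is the full subcomplex on \<open>N\<close>.\<close>
  have in_link: "f \<in> link \<Delta> {v0} \<longleftrightarrow> f \<in> \<Delta>" if f: "f \<subseteq> N" for f
  proof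
    assume "f \<in> \<Delta>"
    have "f \<union> {v0} \<in> \<Delta>"
    proof (rule flag_clique[OF \<Delta>])
      show "f \<union> {v0} \<subseteq> vertices \<Delta>" using f v0 by (auto simp: N_def adj.nbrs_def)
      fix x y assume "x \<in> f \<union> {v0}" "y \<in> f \<union> {v0}" "x \<noteq> y"
      then consider "{x, y} \<subseteq> f" | "x = v0" "y \<in> N" | "y = v0" "x \<in> N" using f by blast
      then show "{x, y} \<in> \<Delta>"
        using \<open>f \<in> \<Delta>\<close> down by cases (auto simp: N_def adj.nbrs_def adj_def insert_commute)
    qed
    then show "f \<in> link \<Delta> {v0}"
      using \<open>f \<in> \<Delta>\<close> f by (auto simp: link_def N_def adj.nbrs_def adj_def)
  qed (simp add: link_def)
  obtain \<phi> where \<phi>: "bij_betw \<phi> N (vertices (suspension \<Gamma>))" "(\<lambda>f. \<phi> ` f) ` link \<Delta> {v0} = suspension \<Gamma>"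
    using iso unfolding isomorphic_complexes_def N by blast
  have inj: "inj_on \<phi> N" using \<phi>(1) by (rule bij_betw_imp_inj_on)
  have face: "f \<in> \<Delta> \<longleftrightarrow> \<phi> ` f \<in> suspension \<Gamma>" if f: "f \<subseteq> N" for f
  proof -
    have "\<phi> ` f \<in> suspension \<Gamma> \<longleftrightarrow> f \<in> link \<Delta> {v0}"
    proof
      assume "\<phi> ` f \<in> suspension \<Gamma>"
      then have "\<phi> ` f \<in> (\<lambda>f. \<phi> ` f) ` link \<Delta> {v0}" unfolding \<phi>(2) .
      then obtain g where g: "g \<in> link \<Delta> {v0}" "\<phi> ` f = \<phi> ` g" by blast
      then have "g \<subseteq> N" using N by (auto simp: vertices_def)
      then have "f = g" using inj_on_image_eq_iff[OF inj f] g(2) by blast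
      then show "f \<in> link \<Delta> {v0}" using g by simp
    qed (use \<phi>(2) in blast)
    then show ?thesis using in_link[OF f] by simp
  qed
  have susp: "s <+> f \<in> suspension \<Gamma> \<longleftrightarrow> s \<in> two_points \<and> f \<in> \<Gamma>" for s f
  proof -
    have "Inl -` (s <+> f) = s" "Inr -` (s <+> f) = f" for s :: "bool set" and f :: "'b set"
      by auto
    then have "s = s' \<and> f = f'" if "s <+> f = s' <+> f'" for s s' :: "bool set" and f f' :: "'b set"
      using that by metis
    then show ?thesis unfolding suspension_def join_def by blast
  qed
  have vert: "y \<in> vertices \<Gamma> \<longleftrightarrow> {y} \<in> \<Gamma>" for y
    using simplicial_complexD(3)[OF \<Gamma>] by (auto simp: vertices_def)
  have "vertices two_points = UNIV" by (auto simp: vertices_def two_points_def)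
  then have "vertices (suspension \<Gamma>) = UNIV <+> vertices \<Gamma>"
    using vertices_join[OF _ simplicial_complexD(2)[OF \<Gamma>], of two_points]
    by (simp add: suspension_def two_points_def)
  then have image: "\<phi> ` N = UNIV <+> vertices \<Gamma>" using \<phi>(1) by (simp add: bij_betw_def)
  then have "Inl False \<in> \<phi> ` N" "Inl True \<in> \<phi> ` N" by auto
  then obtain a b where a: "a \<in> N" "\<phi> a = Inl False" and b: "b \<in> N" "\<phi> b = Inl True"
    by (metis imageE)
  have Inr: "adj \<Delta> a x" if x: "x \<in> N" "\<phi> x = Inr y" for x y
  proof -
    have "Inr y \<in> \<phi> ` N" using x by (metis imageI)
    then have "{y} \<in> \<Gamma>" unfolding image vert[symmetric] by auto
    moreover have "\<phi> ` {a, x} = {False} <+> {y}" using a x by auto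
    ultimately have "{a, x} \<in> \<Delta>" using face[of "{a, x}"] susp[of "{False}" "{y}"] a x
      by (simp add: two_points_def)
    then show ?thesis using a x by (auto simp: adj_def)
  qed
  have nb: "\<not> adj \<Delta> a b"
  proof
    assume "adj \<Delta> a b"
    then have "\<phi> ` {a, b} \<in> suspension \<Gamma>" using face[of "{a, b}"] a b by (simp add: adj_def)
    moreover have "\<phi> ` {a, b} = {False, True} <+> {}" using a b by auto
    ultimately have "{False, True} \<in> two_points" using susp by metis
    then show False by (auto simp: two_points_def)
  qed
  have cases: "x = a \<or> x = b \<or> (\<exists>y. \<phi> x = Inr y)" if x: "x \<in> N" for x
  proof (cases "\<phi> x")
    case (Inl s)
    then have "\<phi> x = \<phi> a \<or> \<phi> x = \<phi> b" using a b by (cases s) auto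
    then show ?thesis using inj_onD[OF inj] x a b by blast
  qed simp
  have "a \<noteq> b" using a b by auto
  have "adj \<Delta> a x \<longleftrightarrow> (\<exists>y. \<phi> x = Inr y)" if "x \<in> N" for x
    using cases[OF that] nb Inr[OF that] adj.irrefl[of \<Delta> a] a b by auto
  then have A: "adj.nbrs \<Delta> N a = {x \<in> N. \<exists>y. \<phi> x = Inr y}"
    by (auto simp: adj.nbrs_def)
  define \<theta> where "\<theta> x = projr (\<phi> x)" for x
  have \<theta>: "\<phi> x = Inr (\<theta> x)" if "x \<in> adj.nbrs \<Delta> N a" for x
    using that unfolding A \<theta>_def by auto
  show thesis
  proof
    show "a \<in> N" by (rule a)
    show "adj.nonnbrs \<Delta> N a = {b}"
      using cases Inr nb b \<open>a \<noteq> b\<close> by (auto simp: adj.nonnbrs_def)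
    show "bij_betw \<theta> (adj.nbrs \<Delta> N a) (vertices \<Gamma>)"
    proof (rule bij_betw_imageI)
      show "inj_on \<theta> (adj.nbrs \<Delta> N a)"
      proof (rule inj_onI)
        fix x y assume *: "x \<in> adj.nbrs \<Delta> N a" "y \<in> adj.nbrs \<Delta> N a" "\<theta> x = \<theta> y"
        then have "\<phi> x = \<phi> y" using \<theta> by metis
        then show "x = y" using inj_onD[OF inj] * by (simp add: adj.nbrs_def)
      qed
      show "\<theta> ` adj.nbrs \<Delta> N a = vertices \<Gamma>"
      proof (intro equalityI subsetI)
        fix y assume "y \<in> \<theta> ` adj.nbrs \<Delta> N a"
        then obtain x where "x \<in> adj.nbrs \<Delta> N a" "y = \<theta> x" by blast
        then have "x \<in> N" "Inr y = \<phi> x" using \<theta>[of x] by (simp_all add: adj.nbrs_def)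
        then have "Inr y \<in> \<phi> ` N" by simp
        then show "y \<in> vertices \<Gamma>" unfolding image by auto
      next
        fix y assume "y \<in> vertices \<Gamma>"
        then have "Inr y \<in> \<phi> ` N" unfolding image by auto
        then obtain x where x: "x \<in> N" "\<phi> x = Inr y" by (metis imageE)
        then have "x \<in> adj.nbrs \<Delta> N a" "y = \<theta> x" unfolding A by (simp_all add: \<theta>_def)
        then show "y \<in> \<theta> ` adj.nbrs \<Delta> N a" by blast
      qed
    qed
    show "f \<in> \<Delta> \<longleftrightarrow> \<theta> ` f \<in> \<Gamma>" if f: "f \<subseteq> adj.nbrs \<Delta> N a" for f
    proof -
      have "\<phi> ` f = {} <+> \<theta> ` f" using f \<theta> by (force simp: Plus_def image_iff)
      moreover have "f \<subseteq> N" using f by (auto simp: adj.nbrs_def)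
      ultimately show ?thesis using face[of f] susp[of "{}" "\<theta> ` f"] by (simp add: two_points_def)
    qed
  qed
qed

text \<open>The gamma polynomial of \<open>\<Delta>\<close> is that of \<open>\<Gamma>\<close> times
  \<open>1 + (k - 4)t\<close>, and \<open>k \<ge> 5\<close> makes \<open>k - 4\<close> the leading
  coefficient of the second factor.\<close>

lemma gamma_poly_join_cycle:
  assumes \<Gamma>: "homology_sphere TYPE('k::field) (int e - 1) \<Gamma>" and k: "k \<ge> 5"
    and iso: "isomorphic_complexes \<Delta> (join \<Gamma> (cycle_complex k))"
  shows "(int k - 4) dvd lead_coeff (gamma_poly (e + 2) \<Delta>)"
proof -
  have sc: "simplicial_complex \<Gamma>" "pure_of_dim (int e - 1) \<Gamma>"
    using \<Gamma> by (auto simp: homology_sphere_def)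
  obtain \<gamma> where \<gamma>: "degree \<gamma> \<le> e div 2" "h_poly e \<Gamma> = gamma_expansion e \<gamma>"
    using ex_gamma_expansion[OF h_poly_sphere_symmetric[OF \<Gamma>]] by blast
  have k3: "k \<ge> 3" using k by simp
  have "h_poly (e + 2) \<Delta> = h_poly (e + 2) (join \<Gamma> (cycle_complex k))"
    by (rule h_poly_isomorphic[OF iso])
  also have "\<dots> = h_poly e \<Gamma> * h_poly 2 (cycle_complex k)"
    using simplicial_complexD(4,5)[OF sc(1)] pure_card_le[OF sc] cycle_complex_faces(1,2)[OF k3]
    by (intro h_poly_join) auto
  also have "\<dots> = gamma_expansion (e + 2) (\<gamma> * [:1, int k - 4:])"
    unfolding h_poly_cycle_complex[OF k3] \<gamma>(2) gamma_expansion_times_linear[OF \<gamma>(1)] by simp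
  finally have h: "h_poly (e + 2) \<Delta> = gamma_expansion (e + 2) (\<gamma> * [:1, int k - 4:])" .
  have "degree (\<gamma> * [:1, int k - 4:]) \<le> (e + 2) div 2"
    using degree_mult_le[of \<gamma> "[:1, int k - 4:]"] degree_pCons_le[of 1 "[:int k - 4:]"] \<gamma>(1) by simp
  from gamma_poly_eqI[OF this h]
  have "lead_coeff (gamma_poly (e + 2) \<Delta>) = lead_coeff \<gamma> * lead_coeff [:1, int k - 4:]"
    by (simp only: lead_coeff_mult)
  also have "lead_coeff [:1, int k - 4:] = int k - 4" using k by simp
  finally show ?thesis by simp
qed

section \<open>Suspended links and extremal polar size\<close>

theorem theorem3p5:
  fixes \<Delta> :: "'a set set" and d :: nat and v0 :: 'a
  assumes "flag_homology_sphere TYPE('k::field) (int d - 1) \<Delta>"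
    and "polar_size \<Delta> > 1"
    and "v0 \<in> vertices \<Delta>"
    and "num_antipodes \<Delta> v0 = polar_size \<Delta>"
  shows "(\<forall>\<Gamma> :: 'b set set.
            flag_homology_sphere TYPE('k) (int d - 3) \<Gamma> \<longrightarrow>
            isomorphic_complexes (link \<Delta> {v0}) (suspension \<Gamma>) \<longrightarrow>
              isomorphic_complexes \<Delta> (join \<Gamma> (cycle_complex (polar_size \<Delta> + 3))) \<and>
              (int (polar_size \<Delta>) - 1) dvd lead_coeff (gamma_poly d \<Delta>)) \<and>
         (d \<ge> 4 \<longrightarrow> int (polar_size \<Delta>) = coeff (gamma_poly d \<Delta>) 1 \<longrightarrow>
            isomorphic_complexes \<Delta> (join (cycle_complex 5) (cycle_complex (polar_size \<Delta> + 3))) \<and>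
            d = 4)"
proof (intro conjI allI impI)
  have hs: "homology_sphere TYPE('k) (int d - 1) \<Delta>" and \<Delta>: "simplicial_complex \<Delta>" "flag \<Delta>"
    using assms(1) by (auto simp: flag_homology_sphere_def homology_sphere_def)
  note fin = simplicial_complexD(1)[OF \<Delta>(1)]
  let ?V = "vertices \<Delta>"
  let ?N = "adj.nbrs \<Delta> ?V v0"
  have npm: "adj.npm \<Delta> d ?V" by (rule flag_sphere_npm[OF assms(1)])
  note decomposition = npm_join_decomposition[OF \<Delta> npm assms(3,4)]
  have polar_le: "polar_size \<Delta> \<le> card (adj.nonnbrs \<Delta> ?V v)" if "v \<in> ?V" for v
    using fin that unfolding polar_size_def num_antipodes_def antipodes_eq_nonnbrs by simp
  {
    fix \<Gamma> :: "'b set set"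
    assume sphere: "flag_homology_sphere TYPE('k) (int d - 3) \<Gamma>"
      and link: "isomorphic_complexes (link \<Delta> {v0}) (suspension \<Gamma>)"
    have \<Gamma>: "homology_sphere TYPE('k) (int d - 3) \<Gamma>" "simplicial_complex \<Gamma>"
      using sphere by (auto simp: flag_homology_sphere_def homology_sphere_def)
    obtain a b \<theta> where "a \<in> ?N" "adj.nonnbrs \<Delta> ?N a = {b}"
      "bij_betw \<theta> (adj.nbrs \<Delta> ?N a) (vertices \<Gamma>)"
      "\<And>f. f \<subseteq> adj.nbrs \<Delta> ?N a \<Longrightarrow> f \<in> \<Delta> \<longleftrightarrow> \<theta> ` f \<in> \<Gamma>"
      by (rule link_suspension[OF \<Delta> assms(3) \<Gamma>(2) link]) blast
    then show iso: "isomorphic_complexes \<Delta> (join \<Gamma> (cycle_complex (polar_size \<Delta> + 3)))"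
      using decomposition(2) by blast
    have "d \<noteq> 0" using npm assms(3) by (metis adj.npm.simps(1) empty_iff)
    \<comment> \<open>In dimension zero every vertex has a single antipode, which
      \<open>polar_size \<Delta> > 1\<close> forbids.\<close>
    moreover have "d \<noteq> Suc 0"
    proof
      assume d: "d = Suc 0"
      then obtain x y where "?V = {x, y}" using npm by auto
      then have "card ?V \<le> 2" by (simp add: card_insert_if)
      then show False
        using adj.card_eq_nbrs_nonnbrs[OF fin assms(3), of \<Delta>] polar_le[OF assms(3)] assms(2) by simp
    qed
    ultimately obtain e where d: "d = e + 2" by (metis Suc_1 not0_implies_Suc add_2_eq_Suc')
    have "homology_sphere TYPE('k) (int e - 1) \<Gamma>" using \<Gamma>(1) by (simp add: d)
    \<comment> \<open>For \<open>k = polar_size \<Delta> + 3\<close> the divisor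
      \<open>k - 4\<close> is \<open>polar_size \<Delta> - 1\<close>.\<close>
    from gamma_poly_join_cycle[OF this _ iso] assms(2)
    show "(int (polar_size \<Delta>) - 1) dvd lead_coeff (gamma_poly d \<Delta>)" by (simp add: d)
  }
  assume d4: "d \<ge> 4" and \<gamma>1: "int (polar_size \<Delta>) = coeff (gamma_poly d \<Delta>) 1"
  have "face_number \<Delta> 1 = card ?V"
  proof -
    have "{f \<in> \<Delta>. card f = 1} = (\<lambda>v. {v}) ` ?V"
      using simplicial_complexD(3)[OF \<Delta>(1)] by (auto simp: card_1_singleton_iff vertices_def)
    then show ?thesis by (simp add: face_number_def card_image)
  qed
  moreover have "coeff (gamma_poly d \<Delta>) 1 = int (face_number \<Delta> 1) - 2 * int d"
    by (rule coeff_gamma_poly_1[OF _ simplicial_complexD(2,4,5)[OF \<Delta>(1)] h_poly_sphere_symmetric[OF hs]])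
      (use d4 in simp)
  moreover have "card ?V = 1 + card ?N + polar_size \<Delta>"
    using adj.card_eq_nbrs_nonnbrs[OF fin assms(3), of \<Delta>] assms(4)
    by (simp add: num_antipodes_def antipodes_eq_nonnbrs)
  \<comment> \<open>\<open>\<gamma>1\<close> says
    \<open>card ?V = 2 * d + polar_size \<Delta>\<close>, and \<open>v0\<close> with its antipodes
    takes \<open>1 + polar_size \<Delta>\<close> of these.\<close>
  ultimately have cardN: "card ?N = 2 * (d - 1) + 1" using \<gamma>1 d4 by simp
  obtain e where e: "d = Suc (Suc (Suc e))" "e \<ge> 1"
    using d4 by (intro that[of "d - 3"]) simp_all
  have finN: "finite ?N" using fin by (auto simp: adj.nbrs_def)
  have npmN: "adj.npm \<Delta> (d - 1) ?N" using adj.npm_nbrs[of \<Delta> "d - 1"] npm assms(3) e by simp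
  have "3 \<le> d - 1" using d4 by simp
  then obtain a b where a: "a \<in> ?N" "adj.nonnbrs \<Delta> ?N a = {b}"
    using adj.vertex_with_unique_nonnbr[OF npmN finN cardN] by blast
  define A where "A = adj.nbrs \<Delta> ?N a"
  note decomposition = decomposition[OF a, folded A_def]
  have finA: "finite A" and AV: "A \<subseteq> ?V" using fin by (auto simp: A_def adj.nbrs_def)
  \<comment> \<open>Dropping the poles \<open>a\<close> and \<open>b\<close> from \<open>?N\<close>
    leaves \<open>A\<close> again one vertex above the minimum for its dimension.\<close>
  have cardA: "card A = 2 * (d - 2) + 1"
    using adj.card_eq_nbrs_nonnbrs[OF finN a(1), of \<Delta>] a(2) cardN e by (simp add: A_def)
  have npmA: "adj.npm \<Delta> (d - 2) A"
    using adj.npm_nbrs[of \<Delta> "d - 2" ?N a] npmN a(1) e by (simp add: A_def)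
  show d: "d = 4"
  proof (rule ccontr)
    assume "d \<noteq> 4"
    then have "3 \<le> d - 2" using d4 by simp
    then obtain x y where x: "x \<in> A" "adj.nonnbrs \<Delta> A x = {y}"
      using adj.vertex_with_unique_nonnbr[OF npmA finA cardA] by blast
    \<comment> \<open>\<open>x\<close> is adjacent to every vertex outside \<open>A\<close>, so its
      single antipode in \<open>A\<close> is its only one in \<open>\<Delta>\<close>.\<close>
    have "adj.nonnbrs \<Delta> ?V x \<subseteq> adj.nonnbrs \<Delta> A x"
      using decomposition(1)[OF x(1)] by (auto simp: adj.nonnbrs_def)
    then have "card (adj.nonnbrs \<Delta> ?V x) \<le> card {y}"
      unfolding x(2) by (rule card_mono[rotated]) simp
    then show False using polar_le[of x] x(1) AV assms(2) by auto
  qed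
  \<comment> \<open>For \<open>d = 4\<close> the graph on \<open>A\<close> is a normal
    pseudomanifold of dimension one with five vertices, that is, a pentagon.\<close>
  have card5: "card A = 5" using cardA d by simp
  have "adj.npm \<Delta> (Suc (Suc 0)) A" using npmA d by (simp add: numeral_2_eq_2)
  then have A: "adj.two_regular \<Delta> A" "adj.connected_on \<Delta> A" "A \<noteq> {}"
    by (auto simp: adj.two_regular_def)
  obtain \<theta> where "bij_betw \<theta> A {..<card A}"
    "\<And>f. f \<subseteq> A \<Longrightarrow> f \<in> \<Delta> \<longleftrightarrow> \<theta> ` f \<in> cycle_complex (card A)"
    by (rule cycle_isomorphism[OF finA A(3,1,2) \<Delta>(1) AV]) blast
  then show "isomorphic_complexes \<Delta> (join (cycle_complex 5) (cycle_complex (polar_size \<Delta> + 3)))"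
    using decomposition(2)[of \<theta> "cycle_complex 5"] cycle_complex_faces(3)[of 5] card5 by simp
qed

end
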